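(* Let $\Sigma_1,\ldots,\Sigma_r$ be signed graphs, where $\Sigma_i$ has $n_i$ vertices, $m_i$ edges and Laplacian eigenvalues $\lambda_{ij}^L$ ($1\le j\le n_i$). Let $\Sigma=\Sigma_1\times\cdots\times\Sigma_r$ be the Cartesian product, which has order $n=n_1\cdots n_r$, average degree $\bar d(\Sigma)=\sum_{i=1}^r\bar d(\Sigma_i)$ and size (number of edges) $m=\frac12n\bar d(\Sigma)$. Then the line graph $\Lambda(\Sigma)$ has eigenvalues $$\lambda_{j_1j_2\ldots j_r}=2-(\lambda_{1j_1}^L+\cdots+\lambda_{rj_r}^L),\qquad 1\le j_i\le n_i,$$ of which exactly $b(\Sigma)=b(\Sigma_1)\cdots b(\Sigma_r)$ are equal to $2$ and the remainder are $<2$, together with $m-n=n(\frac12\bar d(\Sigma)-1)$ additional eigenvalues equal to $2$ (if $m-n<0$, this means that $n-m$ is to be deducted from the previously stated multiplicity $b(\Sigma)$ of the eigenvalue $2$). Its energy is $$E(\Lambda(\Sigma))=\sum_{j_1=1}^{n_1}\cdots\sum_{j_r=1}^{n_r}|\lambda_{1j_1}^L+\cdots+\lambda_{rj_r}^L-2|+2(m-n).$$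
   Context: All graphs are finite, simple and loop-free. A signed graph $\Sigma=(G,\sigma)$ is a graph $G=(V,E)$ with a function $\sigma:E\to\{+1,-1\}$. The sign of a cycle is the product of its edge signs; a signed graph is balanced if every cycle is positive. $b(\Sigma)$ is the number of connected components of $\Sigma$ that are balanced. The adjacency matrix $A(\Sigma)$ has $(u,v)$ entry $\sigma(uv)$ if $u,v$ are adjacent and $0$ otherwise; its eigenvalues are the eigenvalues of $\Sigma$, and the energy $E(\Sigma)$ is the sum of their absolute values. The Laplacian matrix is $L(\Sigma)=D(\Sigma)-A(\Sigma)$, $D(\Sigma)$ being the diagonal matrix of vertex degrees in $G$; its eigenvalues are the Laplacian eigenvalues. The average degree is $\bar d(\Sigma)=2|E|/|V|$. The Cartesian product of signed graphs $\Sigma_i=(V_i,E_i,\sigma_i)$ is the signed graph on $V_1\times\cdots\times V_r$ in which $(u_1,\ldots,u_r)$ and $(v_1,\ldots,v_r)$ are adjacent iff there is an index $i$ with $u_iv_i\in E_i$ and $u_j=v_j$ for all $j\ne i$, such an edge having sign $\sigma_i(u_iv_i)$. Incidence matrix of a signed graph with $n$ vertices and $m$ edges: an $n\times m$ matrix $H(\Sigma)=[\eta_{ik}]$ with $\eta_{ik}=0$ if vertex $v_i$ is not incident with edge $e_k$, $\eta_{ik}=\pm1$ if it is, and $\eta_{ik}\eta_{jk}=-\sigma(v_iv_j)$ for each edge $e_k=v_iv_j$; unique up to multiplying columns by $-1$. Line graph: $\Lambda(\Sigma)$ is the signed graph whose underlying graph is the ordinary line graph of $G$, with signature given by $A(\Lambda(\Sigma))=2I_m-H(\Sigma)^{\mathrm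 T}H(\Sigma)$ (so every cycle of $\Sigma$ becomes a cycle of the same sign, and any three edges at a common vertex become a negative triangle); the choice of $H(\Sigma)$ does not affect eigenvalues. *)

theory Defs
  imports "Jordan_Normal_Form.Char_Poly"
begin

section \<open>Signed graphs\<close>

text \<open>
  Edges are two-element sets of vertices, so graphs are simple and loop-free; only the values of
  \<open>sig\<close> on edges matter. The null graph is allowed, since the line graph of an edgeless graph
  is null.
\<close>

record 'a sgraph =
  verts :: "'a set"
  edges :: "'a set set"
  sig :: "'a set \<Rightarrow> int"

definition signed_graph :: "'a sgraph \<Rightarrow> bool" where
  "signed_graph G \<longleftrightarrow>
     finite (verts G) \<and>
     (\<forall>e\<in>edges G. e \<subseteq> verts G \<and> card e = 2) \<and>
     (\<forall>e\<in>edges G. sig G e \<in> {1, -1})"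

definition degree_at :: "'a sgraph \<Rightarrow> 'a \<Rightarrow> nat" where
  "degree_at G v = card {e \<in> edges G. v \<in> e}"

definition average_degree :: "'a sgraph \<Rightarrow> real" where
  "average_degree G = 2 * real (card (edges G)) / real (card (verts G))"


subsection \<open>Balance\<close>

text \<open>A cycle is given by the list of its distinct vertices in cyclic order.\<close>

definition is_cycle :: "'a sgraph \<Rightarrow> 'a list \<Rightarrow> bool" where
  "is_cycle G xs \<longleftrightarrow>
     length xs \<ge> 3 \<and> distinct xs \<and>
     (\<forall>i<length xs. {xs ! i, xs ! (Suc i mod length xs)} \<in> edges G)"

definition cycle_sign :: "'a sgraph \<Rightarrow> 'a list \<Rightarrow> int" where
  "cycle_sign G xs = (\<Prod>i<length xs. sig G {xs ! i, xs ! (Suc i mod length xs)})"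

definition balanced :: "'a sgraph \<Rightarrow> bool" where
  "balanced G \<longleftrightarrow> (\<forall>xs. is_cycle G xs \<longrightarrow> cycle_sign G xs = 1)"

definition induced :: "'a sgraph \<Rightarrow> 'a set \<Rightarrow> 'a sgraph" where
  "induced G C = \<lparr>verts = C, edges = {e \<in> edges G. e \<subseteq> C}, sig = sig G\<rparr>"

definition connection :: "'a sgraph \<Rightarrow> ('a \<times> 'a) set" where
  "connection G = {(u, v). u \<in> verts G \<and> v \<in> verts G \<and> (u, v) \<in> {(x, y). {x, y} \<in> edges G}\<^sup>*}"

definition graph_components :: "'a sgraph \<Rightarrow> 'a sgraph set" where
  "graph_components G = induced G ` (verts G // connection G)"

definition num_balanced :: "'a sgraph \<Rightarrow> nat" where
  "num_balanced G = card {K \<in> graph_components G. balanced K}"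


section \<open>Matrices and eigenvalues\<close>

text \<open>
  A matrix whose rows and columns are indexed by a finite set is realised along an arbitrary
  enumeration of that set; by \<open>eigenvalues_mat_on\<close> below its eigenvalues do not depend on it.
\<close>

definition enumeration :: "'a set \<Rightarrow> 'a list" where
  "enumeration A = (SOME xs. distinct xs \<and> set xs = A)"

definition mat_along :: "'a list \<Rightarrow> ('a \<Rightarrow> 'a \<Rightarrow> real) \<Rightarrow> real mat" where
  "mat_along xs f = mat (length xs) (length xs) (\<lambda>(i, j). f (xs ! i) (xs ! j))"

definition mat_on :: "'a set \<Rightarrow> ('a \<Rightarrow> 'a \<Rightarrow> real) \<Rightarrow> real mat" where
  "mat_on A f = mat_along (enumeration A) f"

text \<open>
  Eigenvalues are counted with algebraic multiplicity. All matrices below are real symmetric, so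
  the real roots of the characteristic polynomial are all its roots.
\<close>

definition eigenvalues :: "real mat \<Rightarrow> real multiset" where
  "eigenvalues M = proots (char_poly M)"

definition adjacency :: "'a sgraph \<Rightarrow> 'a \<Rightarrow> 'a \<Rightarrow> int" where
  "adjacency G u v = (if {u, v} \<in> edges G then sig G {u, v} else 0)"

definition adjacency_mat :: "'a sgraph \<Rightarrow> real mat" where
  "adjacency_mat G = mat_on (verts G) (\<lambda>u v. of_int (adjacency G u v))"

definition degree_mat :: "'a sgraph \<Rightarrow> real mat" where
  "degree_mat G = mat_on (verts G) (\<lambda>u v. if u = v then of_nat (degree_at G u) else 0)"

definition laplacian_mat :: "'a sgraph \<Rightarrow> real mat" where
  "laplacian_mat G = degree_mat G - adjacency_mat G"

definition energy :: "'a sgraph \<Rightarrow> real" where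
  "energy G = (\<Sum>x\<in>#eigenvalues (adjacency_mat G). \<bar>x\<bar>)"


section \<open>Cartesian products\<close>

text \<open>
  Vertices of the product are extensional functions on the index set. If \<open>e\<close> is an edge of the
  product, then \<open>i\<close> below is the one coordinate in which its ends differ
  (see \<open>sig_cart_prod\<close>).
\<close>

definition cart_prod :: "'i set \<Rightarrow> ('i \<Rightarrow> 'a sgraph) \<Rightarrow> ('i \<Rightarrow> 'a) sgraph" where
  "cart_prod I S =
     \<lparr>verts = (\<Pi>\<^sub>E i\<in>I. verts (S i)),
      edges = {{u, v} | u v. u \<in> (\<Pi>\<^sub>E i\<in>I. verts (S i)) \<and> v \<in> (\<Pi>\<^sub>E i\<in>I. verts (S i)) \<and>
                 (\<exists>i\<in>I. {u i, v i} \<in> edges (S i) \<and> (\<forall>j\<in>I - {i}. u j = v j))},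
      sig = (\<lambda>e. let i = (THE i. i \<in> I \<and> (\<lambda>u. u i) ` e \<in> edges (S i))
                 in sig (S i) ((\<lambda>u. u i) ` e))\<rparr>"


section \<open>Incidence matrices and line graphs\<close>

definition incidence_matrix :: "'a sgraph \<Rightarrow> ('a \<Rightarrow> 'a set \<Rightarrow> int) \<Rightarrow> bool" where
  "incidence_matrix G H \<longleftrightarrow>
     (\<forall>v\<in>verts G. \<forall>e\<in>edges G. if v \<in> e then H v e \<in> {1, -1} else H v e = 0) \<and>
     (\<forall>u v. {u, v} \<in> edges G \<longrightarrow> H u {u, v} * H v {u, v} = - sig G {u, v})"

text \<open>
  The sign of an edge \<open>{e, f}\<close> of the line graph is the off-diagonal entry
  \<open>- (\<Sum>v. H v e * H v f)\<close> of \<open>2I - H\<^sup>TH\<close>; see \<open>adjacency_line_graph\<close>.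
\<close>

definition line_graph :: "'a sgraph \<Rightarrow> ('a \<Rightarrow> 'a set \<Rightarrow> int) \<Rightarrow> 'a set sgraph" where
  "line_graph G H =
     \<lparr>verts = edges G,
      edges = {{e, f} | e f. e \<in> edges G \<and> f \<in> edges G \<and> e \<noteq> f \<and> e \<inter> f \<noteq> {}},
      sig = (\<lambda>X. - (\<Sum>v\<in>verts G. \<Prod>e\<in>X. H v e))\<rparr>"


section \<open>Well-definedness\<close>

lemma enumeration:
  assumes "finite A"
  shows "distinct (enumeration A)" "set (enumeration A) = A"
  using someI_ex[of "\<lambda>xs. distinct xs \<and> set xs = A"] finite_distinct_list[OF assms]
  unfolding enumeration_def by auto

lemma char_poly_mat_along:
  assumes "distinct xs" "distinct ys" "set xs = set ys"
  shows "char_poly (mat_along xs f) = char_poly (mat_along ys f)"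
proof -
  let ?n = "length xs"
  have len: "length ys = ?n"
    using assms by (metis distinct_card)
  have "\<exists>p. p permutes {..<?n} \<and> (\<forall>i<?n. xs ! i = ys ! p i)"
  proof -
    have "mset ys = mset xs"
      using assms by (simp add: set_eq_iff_mset_eq_distinct)
    then obtain p where p: "p permutes {..<length ys}" "permute_list p ys = xs"
      by (metis mset_eq_permutation)
    moreover have "xs ! i = ys ! p i" if "i < ?n" for i
      using p(2) that len permute_list_nth[OF p(1)] by metis
    ultimately show ?thesis
      using len by auto
  qed
  then obtain p where p: "p permutes {..<?n}" and nth: "\<And>i. i < ?n \<Longrightarrow> xs ! i = ys ! p i"
    by auto
  have p_less: "p i < ?n" if "i < ?n" for i
    using permutes_in_image[OF p, of i] that by auto
  let ?q = "Hilbert_Choice.inv p"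
  have q_less: "?q i < ?n" if "i < ?n" for i
    using permutes_in_image[OF permutes_inv[OF p], of i] that by auto
  have pq: "p (?q i) = i" and qp: "?q (p i) = i" for i
    using p by (simp_all add: permutes_inverses)
  define P :: "real mat" where "P = mat ?n ?n (\<lambda>(i, j). if p i = j then 1 else 0)"
  define Q :: "real mat" where "Q = mat ?n ?n (\<lambda>(i, j). if p j = i then 1 else 0)"
  have p_eq: "(p i = p j) = (i = j)" and q_eq: "(?q i = ?q j) = (i = j)" for i j
    using pq qp by metis+
  have *: "(p k = i) = (?q i = k)" for k i
    using pq qp by metis
  have delta: "(\<Sum>k = 0..<?n. (if a = k then 1 else 0) * (if b = k then 1 else 0 :: real)) =
      (if a = b then 1 else 0)" if "a < ?n" for a b
    using that by (subst sum.remove[of _ a]) (auto intro!: sum.neutral)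
  have 1: "P * Q = 1\<^sub>m ?n"
    by (rule eq_matI) (simp_all add: P_def Q_def scalar_prod_def delta p_less p_eq)
  have delta': "(\<Sum>k = 0..<?n. (if p k = i then 1 else 0) * (if p k = j then 1 else 0 :: real)) =
      (if i = j then 1 else 0)" if "i < ?n" for i j
    using delta[of "?q i" "?q j"] q_less[OF that] by (simp add: * q_eq)
  have 2: "Q * P = 1\<^sub>m ?n"
    by (rule eq_matI) (simp_all add: P_def Q_def scalar_prod_def delta')
  have 3: "P * mat_along ys f = mat ?n ?n (\<lambda>(i, j). f (ys ! p i) (ys ! j))"
    by (rule eq_matI)
      (auto simp: P_def scalar_prod_def mat_along_def len p_less sum.delta' if_distrib
        if_distribR cong: if_cong)
  have 4: "P * mat_along ys f * Q = mat_along xs f"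
    unfolding 3
    by (rule eq_matI)
      (auto simp: Q_def scalar_prod_def mat_along_def len p_less nth sum.delta' if_distrib
        cong: if_cong)
  have "similar_mat_wit (mat_along xs f) (mat_along ys f) P Q"
    unfolding similar_mat_wit_def Let_def
    using 1 2 4 by (auto simp: P_def Q_def mat_along_def len)
  then show ?thesis
    by (intro char_poly_similar) (auto simp: similar_mat_def)
qed

lemma eigenvalues_mat_on:
  assumes "distinct xs" "set xs = A"
  shows "eigenvalues (mat_on A f) = eigenvalues (mat_along xs f)"
proof -
  have "finite A"
    using assms by auto
  then show ?thesis
    unfolding eigenvalues_def mat_on_def
    using char_poly_mat_along[of "enumeration A" xs f] enumeration[of A] assms by simp
qed

lemma edge_ends:
  assumes "signed_graph G" "{u, v} \<in> edges G"
  shows "u \<noteq> v" "u \<in> verts G" "v \<in> verts G"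
  using assms unfolding signed_graph_def by (auto dest!: bspec[of _ _ "{u, v}"] split: if_splits)

lemma sig_cart_prod:
  assumes "\<And>i. i \<in> I \<Longrightarrow> signed_graph (S i)"
    and "i \<in> I" "{u i, v i} \<in> edges (S i)" "\<And>j. j \<in> I - {i} \<Longrightarrow> u j = v j"
  shows "sig (cart_prod I S) {u, v} = sig (S i) {u i, v i}"
proof -
  have "(THE k. k \<in> I \<and> {u k, v k} \<in> edges (S k)) = i"
  proof (rule the_equality)
    show "k = i" if "k \<in> I \<and> {u k, v k} \<in> edges (S k)" for k
      using that assms(4)[of k] edge_ends(1)[OF assms(1), of k "u k" "v k"] by auto
  qed (use assms in auto)
  then show ?thesis
    by (simp add: cart_prod_def)
qed

lemma signed_graph_cart_prod:
  assumes "finite I" "\<And>i. i \<in> I \<Longrightarrow> signed_graph (S i)"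
  shows "signed_graph (cart_prod I S)"
proof -
  have "e \<subseteq> verts (cart_prod I S) \<and> card e = 2 \<and> sig (cart_prod I S) e \<in> {1, -1}"
    if e: "e \<in> edges (cart_prod I S)" for e
  proof -
    obtain u v i where *: "e = {u, v}" "u \<in> verts (cart_prod I S)" "v \<in> verts (cart_prod I S)"
      "i \<in> I" "{u i, v i} \<in> edges (S i)" "\<And>j. j \<in> I - {i} \<Longrightarrow> u j = v j"
      using e by (auto simp: cart_prod_def)
    have "sig (S i) {u i, v i} \<in> {1, -1}"
      using assms(2)[OF *(4)] *(5) unfolding signed_graph_def by blast
    moreover have "u \<noteq> v"
      using edge_ends(1)[OF assms(2)[OF *(4)] *(5)] by auto
    ultimately show ?thesis
      using sig_cart_prod[of I S i u v] assms(2) * by simp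
  qed
  moreover have "finite (verts (cart_prod I S))"
    using assms by (auto simp: cart_prod_def signed_graph_def intro!: finite_PiE)
  ultimately show ?thesis
    unfolding signed_graph_def by blast
qed

lemma ex_incidence_matrix:
  assumes "signed_graph G"
  shows "\<exists>H. incidence_matrix G H"
proof -
  define a where "a e = (SOME v. v \<in> e)" for e :: "'a set"
  define H where "H v e = (if v \<in> e then if v = a e then 1 else - sig G e else 0)" for v e
  have a: "a {u, v} = u \<or> a {u, v} = v" for u v
    using someI[of "\<lambda>x. x \<in> {u, v}" u] unfolding a_def by auto
  have "H u {u, v} * H v {u, v} = - sig G {u, v}" if "{u, v} \<in> edges G" for u v
    using a[of u v] edge_ends(1)[OF assms that] by (auto simp: H_def)
  moreover have "H v e \<in> {1, -1}" if "e \<in> edges G" "v \<in> e" for v e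
    using that assms unfolding H_def signed_graph_def by auto
  ultimately show ?thesis
    unfolding incidence_matrix_def by (intro exI[of _ H]) (auto simp: H_def)
qed

lemma incidence_product:
  assumes "signed_graph G" "incidence_matrix G H" "e \<in> edges G" "f \<in> edges G" "e \<noteq> f"
  shows "(\<Sum>v\<in>verts G. H v e * H v f) \<in> (if e \<inter> f = {} then {0} else {1, -1})"
proof -
  have fin: "finite (verts G)" and sub: "e \<subseteq> verts G" "f \<subseteq> verts G"
    and card: "card e = 2" "card f = 2"
    using assms unfolding signed_graph_def by auto
  have z: "H v e * H v f = 0" if "v \<in> verts G - e \<inter> f" for v
    using assms that unfolding incidence_matrix_def by auto
  have sum: "(\<Sum>v\<in>verts G. H v e * H v f) = (\<Sum>v\<in>e \<inter> f. H v e * H v f)"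
    using fin sub z by (intro sum.mono_neutral_right) auto
  show ?thesis
  proof (cases "e \<inter> f = {}")
    case True
    then show ?thesis
      using sum by simp
  next
    case False
    then obtain w where w: "w \<in> e" "w \<in> f"
      by auto
    have "e \<inter> f = {w}"
      using w card assms(5) by (auto simp: card_2_iff)
    moreover have "H w e \<in> {1, -1}" "H w f \<in> {1, -1}"
      using w sub assms unfolding incidence_matrix_def by (auto split: if_splits)
    ultimately show ?thesis
      using sum by auto
  qed
qed

lemma signed_graph_line_graph:
  assumes "signed_graph G" "incidence_matrix G H"
  shows "signed_graph (line_graph G H)"
proof -
  have "finite (edges G)"
    using assms(1) unfolding signed_graph_def
    by (metis PowI finite_Pow_iff finite_subset subsetI)
  moreover have "X \<subseteq> edges G \<and> card X = 2 \<and> sig (line_graph G H) X \<in> {1, -1}"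
    if X: "X \<in> edges (line_graph G H)" for X
  proof -
    obtain e f where *: "X = {e, f}" "e \<in> edges G" "f \<in> edges G" "e \<noteq> f" "e \<inter> f \<noteq> {}"
      using X by (auto simp: line_graph_def)
    then show ?thesis
      using incidence_product[OF assms *(2,3,4)] by (auto simp: line_graph_def)
  qed
  ultimately show ?thesis
    unfolding signed_graph_def by (simp add: line_graph_def)
qed

lemma adjacency_line_graph:
  assumes "signed_graph G" "incidence_matrix G H" "e \<in> edges G" "f \<in> edges G"
  shows "adjacency (line_graph G H) e f = (if e = f then 2 else 0) - (\<Sum>v\<in>verts G. H v e * H v f)"
proof (cases "e = f")
  case True
  have e: "finite (verts G)" "e \<subseteq> verts G" "card e = 2"
    using assms unfolding signed_graph_def by auto
  have "(\<Sum>v\<in>verts G. H v e * H v e) = (\<Sum>v\<in>verts G. if v \<in> e then 1 else 0)"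
  proof (rule sum.cong)
    show "H v e * H v e = (if v \<in> e then 1 else 0)" if "v \<in> verts G" for v
      using assms(2,3) that unfolding incidence_matrix_def by (force split: if_splits)
  qed simp
  also have "\<dots> = (\<Sum>v\<in>e. 1)"
    using e by (intro sum.mono_neutral_cong_right) auto
  finally have "(\<Sum>v\<in>verts G. H v e * H v e) = 2"
    using e by simp
  then show ?thesis
    using True by (auto simp: adjacency_def line_graph_def doubleton_eq_iff)
next
  case False
  then show ?thesis
    using incidence_product[OF assms False] assms
    by (auto simp: adjacency_def line_graph_def doubleton_eq_iff Int_commute split: if_splits)
qed

end

theory Submission
  imports Defs "Jordan_Normal_Form.Jordan_Normal_Form_Existence"
begin

text \<open>
  If \<open>N\<close> is an incidence matrix of \<open>\<Sigma>\<close>, then \<open>N N\<^sup>T\<close> is the Laplacian and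
  \<open>2 - N\<^sup>T N\<close> is the adjacency matrix of the line graph. Comparing the characteristic
  polynomials of \<open>2 - N N\<^sup>T\<close> and \<open>2 - N\<^sup>T N\<close> transfers the spectrum up to \<open>m - n\<close> copies of 2.
  The Laplacian of a Cartesian product acts coordinatewise, so products of eigenfunctions of the
  factors form an eigenbasis whose eigenvalues are the sums of the given ones. Since
  the Laplacian is positive semidefinite and its kernel is spanned by the switching functions of
  the balanced components, the multiplicity of the eigenvalue zero is \<open>b(\<Sigma>)\<close>; a sum of
  nonnegative eigenvalues vanishes only if all summands do, which makes \<open>b\<close> multiplicative
  without any combinatorics of cycles in the product.
\<close>

section \<open>Diagonalisation of symmetric matrices\<close>

text \<open>The eigenvalues of the factors are given only as a multiset of roots of a characteristic
  polynomial, whereas a basis for the product needs actual eigenfunctions, one for each listed root.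
  As many real roots are listed as there are vertices, so the characteristic polynomial splits over
  the reals and a Jordan normal form exists; symmetry then only has to rule out blocks of size above
  one. The bases are carried as families of functions on abstract index sets rather than as
  matrices, because the vertices of the product and the tuples of the theorem are themselves
  functions: the product basis is indexed by exactly these tuples, and multiplicities become
  cardinalities of sets of tuples.\<close>

text \<open>The only nonzero entries off the diagonal lie in blocks of size at least two. The second
  alternative describes two entire columns, because the chain equations are later read off from the
  columns of \<open>P * J\<close>.\<close>

lemma jordan_matrix_diagonal_or_chain:
  fixes n_as :: "(nat \<times> 'b :: {zero, one}) list"
  defines "N \<equiv> sum_list (map fst n_as)"
  shows "(\<forall>i<N. \<forall>j<N. i \<noteq> j \<longrightarrow> jordan_matrix n_as $$ (i, j) = 0) \<or>
    (\<exists>i a. Suc i < N \<and> (\<forall>l<N.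
       jordan_matrix n_as $$ (l, i) = (if l = i then a else 0) \<and>
       jordan_matrix n_as $$ (l, Suc i) = (if l = Suc i then a else if l = i then 1 else 0)))"
  unfolding N_def
proof (induction n_as)
  case Nil
  then show ?case by simp
next
  case (Cons p n_as)
  obtain n a where p: "p = (n, a)" by force
  let ?M = "sum_list (map fst n_as)"
  let ?J = "jordan_matrix n_as"
  have entry: "jordan_matrix ((n, a) # n_as) $$ (i, j) =
      (if i < n then if j < n then jordan_block n a $$ (i, j) else 0
       else if j < n then 0 else ?J $$ (i - n, j - n))"
    if "i < n + ?M" "j < n + ?M" for i j
    using that by (auto simp: jordan_matrix_Cons)
  show ?case
  proof (cases "n \<le> 1")
    \<comment> \<open>A leading block of size at least two supplies the chain in its first two
      columns, which vanish below the block.\<close>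
    case False
    then show ?thesis
      unfolding p by (intro disjI2 exI[of _ 0] exI[of _ a]) (auto simp: entry)
  next
    case n: True
    from Cons.IH show ?thesis
    proof
      assume "\<forall>i<?M. \<forall>j<?M. i \<noteq> j \<longrightarrow> ?J $$ (i, j) = 0"
      then show ?thesis
        unfolding p using n by (intro disjI1) (auto simp: entry)
    next
      assume "\<exists>i b. Suc i < ?M \<and> (\<forall>l<?M.
         ?J $$ (l, i) = (if l = i then b else 0) \<and>
         ?J $$ (l, Suc i) = (if l = Suc i then b else if l = i then 1 else 0))"
    then obtain i b where i: "Suc i < ?M" and "\<forall>l<?M.
         ?J $$ (l, i) = (if l = i then b else 0) \<and>
         ?J $$ (l, Suc i) = (if l = Suc i then b else if l = i then 1 else 0)"
      by blast
    then have ch: "?J $$ (l, i) = (if l = i then b else 0)"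
        "?J $$ (l, Suc i) = (if l = Suc i then b else if l = i then 1 else 0)" if "l < ?M" for l
      using that by blast+
    have "jordan_matrix ((n, a) # n_as) $$ (l, i + n) = (if l = i + n then b else 0) \<and>
        jordan_matrix ((n, a) # n_as) $$ (l, Suc (i + n)) =
          (if l = Suc (i + n) then b else if l = i + n then 1 else 0)" if "l < n + ?M" for l
      using that i ch[of "l - n"] by (cases "l < n") (auto simp: entry Suc_diff_le)
    then show ?thesis
      unfolding p using i by (intro disjI2 exI[of _ "i + n"] exI[of _ b]) auto
    qed
  qed
qed

text \<open>
  A Jordan chain \<open>A x = a x\<close>, \<open>A y = a y + x\<close> of a symmetric matrix has
  \<open>x \<bullet> x = x \<bullet> (A - a) y = (A - a) x \<bullet> y = 0\<close>, so all Jordan blocks have size one.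
\<close>

lemma symmetric_split_diagonalizable:
  fixes A :: "real mat"
  assumes A: "A \<in> carrier_mat n n"
    and sym: "\<And>i j. i < n \<Longrightarrow> j < n \<Longrightarrow> A $$ (i, j) = A $$ (j, i)"
    and cp: "char_poly A = (\<Prod>a\<leftarrow>as. [:- a, 1:])"
  shows "\<exists>D P Q. similar_mat_wit A D P Q \<and> (\<forall>i<n. \<forall>j<n. i \<noteq> j \<longrightarrow> D $$ (i, j) = 0)"
proof -
  obtain n_as where "jordan_nf A n_as"
    using jordan_nf_exists[OF A cp] by auto
  then obtain P Q where sim: "similar_mat_wit A (jordan_matrix n_as) P Q"
    unfolding jordan_nf_def similar_mat_def by auto
  define J where "J = jordan_matrix n_as"
  from similar_mat_witD2[OF A sim]
  have carr: "J \<in> carrier_mat n n" "P \<in> carrier_mat n n" "Q \<in> carrier_mat n n"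
    and QP: "Q * P = 1\<^sub>m n" and APJ: "A = P * J * Q"
    by (auto simp: J_def)
  have N: "sum_list (map fst n_as) = n"
    using carr(1) unfolding J_def by (metis carrier_matD(1) jordan_matrix_dim(1))
  have AP: "A * P = P * J"
    unfolding APJ using carr QP by (simp add: assoc_mult_mat[of _ n n _ n _ n])
  have "False" if i: "Suc i < n" and ch: "\<And>l. l < n \<Longrightarrow> J $$ (l, i) = (if l = i then a else 0) \<and>
       J $$ (l, Suc i) = (if l = Suc i then a else if l = i then 1 else 0)" for i a
  proof -
    have e: "(\<Sum>m = 0..<n. A $$ (l, m) * P $$ (m, k)) = (\<Sum>m = 0..<n. P $$ (l, m) * J $$ (m, k))"
      if "l < n" "k < n" for l k
      using arg_cong[OF AP, of "\<lambda>M. M $$ (l, k)"] that carr A by (simp add: scalar_prod_def)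
    \<comment> \<open>Columns \<open>i\<close> and \<open>Suc i\<close> of \<open>P\<close> are the
      vectors \<open>x\<close> and \<open>y\<close> of the chain.\<close>
    have x: "(\<Sum>m = 0..<n. A $$ (l, m) * P $$ (m, i)) = a * P $$ (l, i)" if "l < n" for l
    proof -
      have "(\<Sum>m = 0..<n. P $$ (l, m) * J $$ (m, i)) = (\<Sum>m = 0..<n. if m = i then a * P $$ (l, i) else 0)"
        using ch by (intro sum.cong) auto
      then show ?thesis
        using e[OF that, of i] i by simp
    qed
    have y: "(\<Sum>m = 0..<n. A $$ (l, m) * P $$ (m, Suc i)) = a * P $$ (l, Suc i) + P $$ (l, i)"
      if "l < n" for l
    proof -
      have "(\<Sum>m = 0..<n. P $$ (l, m) * J $$ (m, Suc i)) =
          (\<Sum>m = 0..<n. (if m = Suc i then a * P $$ (l, Suc i) else 0) + (if m = i then P $$ (l, i) else 0))"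
        using ch by (intro sum.cong) auto
      then show ?thesis
        using e[OF that, of "Suc i"] i by (simp add: sum.distrib)
    qed
    have "(\<Sum>l = 0..<n. P $$ (l, i) * (a * P $$ (l, Suc i) + P $$ (l, i))) =
        (\<Sum>l = 0..<n. P $$ (l, i) * (\<Sum>m = 0..<n. A $$ (l, m) * P $$ (m, Suc i)))"
      using y by (intro sum.cong) auto
    also have "\<dots> = (\<Sum>m = 0..<n. \<Sum>l = 0..<n. P $$ (l, i) * (A $$ (l, m) * P $$ (m, Suc i)))"
      unfolding sum_distrib_left by (rule sum.swap)
    also have "\<dots> = (\<Sum>m = 0..<n. P $$ (m, Suc i) * (\<Sum>l = 0..<n. A $$ (m, l) * P $$ (l, i)))"
      unfolding sum_distrib_left using sym by (intro sum.cong refl) (simp add: ac_simps)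
    also have "\<dots> = (\<Sum>m = 0..<n. P $$ (m, i) * (a * P $$ (m, Suc i)))"
      using x by (intro sum.cong) auto
    finally have "(\<Sum>l = 0..<n. P $$ (l, i) * P $$ (l, i)) = 0"
      by (simp add: sum.distrib distrib_left)
    then have "P $$ (l, i) = 0" if "l < n" for l
      using that by (subst (asm) sum_nonneg_eq_0_iff) auto
    \<comment> \<open>Column \<open>i\<close> of the invertible matrix \<open>P\<close> has norm
      zero, which contradicts \<open>QP\<close> on the diagonal.\<close>
    then have "(Q * P) $$ (i, i) = 0"
      using carr i by (simp add: scalar_prod_def)
    then show False
      using QP i by simp
  qed
  then have "\<forall>i<n. \<forall>j<n. i \<noteq> j \<longrightarrow> J $$ (i, j) = 0"
    using jordan_matrix_diagonal_or_chain[of n_as] unfolding N J_def by blast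
  then show ?thesis
    using sim unfolding J_def by blast
qed

section \<open>Split polynomials and their multisets of roots\<close>

text \<open>Dividing by one linear factor lowers the degree and the number of roots by one each, so
  no factor without roots can be left over. This turns a complete list of real eigenvalues into the
  factorisation that the Jordan normal form asks for.\<close>

lemma monic_poly_split:
  fixes p :: "'b :: field poly"
  assumes "monic p" "size (proots p) = degree p" "mset es = proots p"
  shows "p = (\<Prod>e\<leftarrow>es. [:- e, 1:])"
  using assms
proof (induction es arbitrary: p)
  case Nil
  then have "degree p = 0" by simp
  then show ?case
    using Nil monic_degree_0[of p] by simp
next
  case (Cons e es)
  have p0: "p \<noteq> 0" using Cons by auto
  have "e \<in># proots p" using Cons by (metis list.set_intros(1) set_mset_mset)
  then have "[:- e, 1:] dvd p"
    using p0 by (simp add: poly_eq_0_iff_dvd)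
  then obtain q where q: "p = [:- e, 1:] * q" by (auto elim: dvdE)
  have q0: "q \<noteq> 0" using p0 q by auto
  have "lead_coeff p = lead_coeff q"
    unfolding q lead_coeff_mult by simp
  moreover have "degree p = Suc (degree q)"
    unfolding q using q0 by (subst degree_mult_eq) auto
  moreover have "proots p = add_mset e (proots q)"
    unfolding q using q0 by (subst proots_mult) auto
  ultimately have "q = (\<Prod>e\<leftarrow>es. [:- e, 1:])"
    using Cons.prems by (intro Cons.IH) auto
  then show ?case
    using q by simp
qed

text \<open>Serves to order an index set so that its values run through a prescribed diagonal entry
  by entry, even when values repeat.\<close>

lemma image_mset_eq_mset:
  assumes "image_mset f M = mset xs"
  shows "\<exists>ys. mset ys = M \<and> map f ys = xs"
  using assms
proof (induction xs arbitrary: M)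
  case (Cons x xs)
  then have "image_mset f M = add_mset x (mset xs)" by simp
  then obtain M' y where "M = add_mset y M'" "f y = x" "image_mset f M' = mset xs"
    by (metis msed_map_invR)
  with Cons.IH[of M'] show ?case
    by (metis list.simps(9) mset.simps(2))
qed simp

section \<open>Eigenfunctions with a dual basis\<close>

lemma sum_nth_distinct:
  assumes "distinct xs"
  shows "(\<Sum>k = 0..<length xs. h (xs ! k)) = sum h (set xs)"
  by (rule sum.reindex_bij_betw) (use assms in \<open>auto intro!: bij_betw_nth\<close>)

text \<open>
  The functions \<open>G i\<close> are the dual basis of the eigenfunctions \<open>F i\<close>; with both at hand no
  orthonormalisation is needed.
\<close>

definition eigensystem ::
  "'a set \<Rightarrow> ('a \<Rightarrow> 'a \<Rightarrow> real) \<Rightarrow> 'b set \<Rightarrow> ('b \<Rightarrow> real) \<Rightarrow> ('b \<Rightarrow> 'a \<Rightarrow> real) \<Rightarrow> ('b \<Rightarrow> 'a \<Rightarrow> real) \<Rightarrow> bool"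
where
  "eigensystem A M I lam F G \<longleftrightarrow>
     (\<forall>i\<in>I. \<forall>j\<in>I. (\<Sum>v\<in>A. G i v * F j v) = (if i = j then 1 else 0)) \<and>
     (\<forall>u\<in>A. \<forall>v\<in>A. (\<Sum>i\<in>I. F i u * G i v) = (if u = v then 1 else 0)) \<and>
     (\<forall>i\<in>I. \<forall>u\<in>A. (\<Sum>v\<in>A. M u v * F i v) = lam i * F i u)"

lemma eigensystemD:
  assumes "eigensystem A M I lam F G"
  shows "\<And>i j. i \<in> I \<Longrightarrow> j \<in> I \<Longrightarrow> (\<Sum>v\<in>A. G i v * F j v) = (if i = j then 1 else 0)"
    and "\<And>u v. u \<in> A \<Longrightarrow> v \<in> A \<Longrightarrow> (\<Sum>i\<in>I. F i u * G i v) = (if u = v then 1 else 0)"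
    and "\<And>i u. i \<in> I \<Longrightarrow> u \<in> A \<Longrightarrow> (\<Sum>v\<in>A. M u v * F i v) = lam i * F i u"
  using assms unfolding eigensystem_def by blast+

text \<open>Both cardinalities are the trace of the same double sum, taken once over the indices and
  once over the points.\<close>

lemma eigensystem_card:
  assumes "eigensystem A M I lam F G"
  shows "card I = card A"
proof -
  note E = eigensystemD[OF assms]
  have "real (card I) = (\<Sum>i\<in>I. \<Sum>v\<in>A. G i v * F i v)"
    using E(1) by simp
  also have "\<dots> = (\<Sum>v\<in>A. \<Sum>i\<in>I. F i v * G i v)"
    by (subst sum.swap) (simp add: mult.commute)
  also have "\<dots> = real (card A)"
    using E(2) by simp
  finally show ?thesis by simp
qed

text \<open>The values of \<open>F\<close> form a matrix whose inverse has the values of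
  \<open>G\<close>; conjugation by it diagonalises the matrix of \<open>M\<close>. Equality of the
  two cardinalities makes these matrices square.\<close>

lemma eigensystem_char_poly:
  assumes "finite A" "finite I" "eigensystem A M I lam F G"
  shows "char_poly (mat_on A M) = (\<Prod>i\<in>I. [:- lam i, 1:])"
proof -
  define xs ys where "xs = enumeration A" and "ys = enumeration I"
  define n where "n = length xs"
  have xs: "distinct xs" "set xs = A" and ys: "distinct ys" "set ys = I"
    unfolding xs_def ys_def using enumeration assms by auto
  have len: "length ys = n" "length xs = n"
    using eigensystem_card[OF assms(3)] xs ys unfolding n_def by (metis distinct_card)+
  note E = eigensystemD[OF assms(3)]
  have mem: "xs ! l \<in> A" "ys ! l \<in> I" if "l < n" for l
    using that xs ys len by auto
  have sumA: "(\<Sum>k = 0..<n. h (xs ! k)) = sum h A" for h :: "_ \<Rightarrow> real"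
    using sum_nth_distinct[OF xs(1), of h] xs len by simp
  have sumI: "(\<Sum>k = 0..<n. h (ys ! k)) = sum h I" for h :: "_ \<Rightarrow> real"
    using sum_nth_distinct[OF ys(1), of h] ys len by simp
  define P where "P = mat n n (\<lambda>(l, k). F (ys ! k) (xs ! l))"
  define Q where "Q = mat n n (\<lambda>(k, l). G (ys ! k) (xs ! l))"
  define D where "D = mat n n (\<lambda>(k, l). if k = l then lam (ys ! k) else 0)"
  have M: "mat_on A M = mat n n (\<lambda>(i, j). M (xs ! i) (xs ! j))"
    unfolding mat_on_def mat_along_def xs_def[symmetric] n_def ..
  have carr: "P \<in> carrier_mat n n" "Q \<in> carrier_mat n n" "D \<in> carrier_mat n n"
      "mat_on A M \<in> carrier_mat n n"
    unfolding M P_def Q_def D_def by auto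
  have PQ: "P * Q = 1\<^sub>m n"
    by (rule eq_matI)
      (auto simp: P_def Q_def scalar_prod_def sumI[of "\<lambda>i. F i _ * G i _"] E(2) mem
        nth_eq_iff_index_eq xs(1) len)
  have QP: "Q * P = 1\<^sub>m n"
    by (rule eq_matI)
      (auto simp: P_def Q_def scalar_prod_def sumA[of "\<lambda>v. G _ v * F _ v"] E(1) mem
        nth_eq_iff_index_eq ys(1) len)
  have delta: "(\<Sum>k = 0..<n. a k * (if k = j then b k else 0)) = a j * b j"
    if "j < n" for a b :: "nat \<Rightarrow> real" and j
    using that by (subst sum.remove[of _ j]) (auto intro!: sum.neutral)
  have "mat_on A M * P = P * D"
    unfolding M
    by (rule eq_matI)
      (auto simp: P_def D_def scalar_prod_def sumA[of "\<lambda>v. M _ v * F _ v"] E(3) mem delta)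
  then have "mat_on A M * (P * Q) = P * D * Q"
    using carr by (metis assoc_mult_mat)
  then have "mat_on A M = P * D * Q"
    using PQ carr by simp
  then have "similar_mat_wit (mat_on A M) D P Q"
    unfolding similar_mat_wit_def Let_def using PQ QP carr by auto
  then have "char_poly (mat_on A M) = char_poly D"
    by (intro char_poly_similar) (auto simp: similar_mat_def)
  also have "\<dots> = (\<Prod>a\<leftarrow>diag_mat D. [:- a, 1:])"
    by (rule char_poly_upper_triangular[OF carr(3)]) (auto simp: D_def)
  also have "diag_mat D = map lam ys"
    by (rule nth_equalityI) (auto simp: diag_mat_def D_def len)
  also have "(\<Prod>a\<leftarrow>map lam ys. [:- a, 1:]) = (\<Prod>i\<in>I. [:- lam i, 1:])"
    using prod.distinct_set_conv_list[OF ys(1), of "\<lambda>i. [:- lam i, 1:]"] ys(2)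
    by (simp add: comp_def)
  finally show ?thesis .
qed

lemma proots_linear_factors: "proots (\<Prod>a\<leftarrow>as. [:- a, 1:]) = mset (as :: 'b :: idom list)"
proof (induction as)
  case (Cons a as)
  have "(\<Prod>a\<leftarrow>as. [:- a, 1:]) \<noteq> 0"
    by (auto simp: prod_list_zero_iff)
  then have "proots ([:- a, 1:] * (\<Prod>a\<leftarrow>as. [:- a, 1:])) =
      proots [:- a, 1:] + proots (\<Prod>a\<leftarrow>as. [:- a, 1:])"
    by (intro proots_mult) auto
  then show ?case
    using Cons.IH by simp
qed simp

text \<open>The labelling \<open>lam\<close> is prescribed and may repeat values, so diagonalising
  is not enough: the columns of \<open>P\<close> must also be labelled by \<open>I\<close> in
  agreement with \<open>lam\<close>.\<close>

lemma ex_eigensystem: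
  assumes fin: "finite A" "finite I" and card: "card I = card A"
    and sym: "\<And>u v. u \<in> A \<Longrightarrow> v \<in> A \<Longrightarrow> M u v = M v u"
    and eig: "eigenvalues (mat_on A M) = image_mset lam (mset_set I)"
  shows "\<exists>F G. eigensystem A M I lam F G"
proof -
  define xs where "xs = enumeration A"
  define n where "n = length xs"
  have xs: "distinct xs" "set xs = A"
    unfolding xs_def using enumeration fin by auto
  have n: "n = card A"
    using xs distinct_card n_def by metis
  have mem: "xs ! l \<in> A" if "l < n" for l
    using that xs unfolding n_def by auto
  define C where "C = mat_on A M"
  have Cm: "C = mat n n (\<lambda>(i, j). M (xs ! i) (xs ! j))"
    unfolding C_def mat_on_def mat_along_def xs_def[symmetric] n_def ..
  then have C: "C \<in> carrier_mat n n" by simp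
  have monic: "monic (char_poly C)" and deg: "degree (char_poly C) = n"
    using degree_monic_char_poly[OF C] by auto
  have roots: "proots (char_poly C) = image_mset lam (mset_set I)"
    using eig unfolding eigenvalues_def C_def .
  obtain es where es: "mset es = proots (char_poly C)"
    using ex_mset by blast
  \<comment> \<open>The number of listed roots is \<open>card I = n\<close>, the degree, so all
    roots are real.\<close>
  have cp: "char_poly C = (\<Prod>e\<leftarrow>es. [:- e, 1:])"
    using monic deg es roots card n by (intro monic_poly_split) auto
  obtain D P Q where sim: "similar_mat_wit C D P Q"
      and diag: "\<forall>i<n. \<forall>j<n. i \<noteq> j \<longrightarrow> D $$ (i, j) = 0"
    using symmetric_split_diagonalizable[OF C _ cp] sym mem by (auto simp: Cm)
  from similar_mat_witD2[OF C sim]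
  have carr: "D \<in> carrier_mat n n" "P \<in> carrier_mat n n" "Q \<in> carrier_mat n n"
    and PQ: "P * Q = 1\<^sub>m n" and QP: "Q * P = 1\<^sub>m n" and CPD: "C = P * D * Q"
    by auto
  have "char_poly C = char_poly D"
    using sim by (intro char_poly_similar) (auto simp: similar_mat_def)
  also have "\<dots> = (\<Prod>a\<leftarrow>diag_mat D. [:- a, 1:])"
    using diag carr by (intro char_poly_upper_triangular) auto
  finally have "proots (char_poly C) = mset (diag_mat D)"
    by (simp add: proots_linear_factors)
  then have "image_mset lam (mset_set I) = mset (diag_mat D)"
    using roots by simp
  \<comment> \<open>\<open>lam\<close> and the diagonal of \<open>D\<close> agree only as multisets;
    \<open>ys\<close> arranges \<open>I\<close> along the diagonal.\<close>
  then obtain ys where ys_mset: "mset ys = mset_set I" and ys_map: "map lam ys = diag_mat D"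
    using image_mset_eq_mset by blast
  have ys: "distinct ys" "set ys = I"
  proof -
    show "set ys = I"
      using arg_cong[OF ys_mset, of set_mset] fin by simp
    then show "distinct ys"
      using arg_cong[OF ys_mset, of size] by (intro card_distinct) simp
  qed
  have len: "length ys = n" "length xs = n"
    using ys card n distinct_card n_def by metis+
  have Dkk: "D $$ (k, k) = lam (ys ! k)" if "k < n" for k
    using arg_cong[OF ys_map, of "\<lambda>zs. zs ! k"] that carr len by (simp add: diag_mat_def)
  have CP: "C * P = P * D"
    unfolding CPD using carr QP by (simp add: assoc_mult_mat[of _ n n _ n _ n])
  \<comment> \<open>Inverting the two enumerations turns the entries of \<open>P\<close> and
    \<open>Q\<close> into functions of points and indices.\<close>
  define row col where "row = the_inv_into {..<n} (nth xs)" and "col = the_inv_into {..<n} (nth ys)"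
  have row: "row (xs ! l) = l" and col: "col (ys ! l) = l" if "l < n" for l
    unfolding row_def col_def using that xs ys len
    by (auto intro!: the_inv_into_f_f inj_on_nth)
  define F where "F i v = P $$ (row v, col i)" for i v
  define G where "G i v = Q $$ (col i, row v)" for i v
  have sumA: "sum h A = (\<Sum>k = 0..<n. h (xs ! k))" for h :: "_ \<Rightarrow> real"
    using sum_nth_distinct[OF xs(1), of h] xs len by simp
  have sumI: "sum h I = (\<Sum>k = 0..<n. h (ys ! k))" for h :: "_ \<Rightarrow> real"
    using sum_nth_distinct[OF ys(1), of h] ys len by simp
  have exA: "\<exists>l<n. u = xs ! l" if "u \<in> A" for u
    using that xs len by (metis in_set_conv_nth)
  have exI: "\<exists>l<n. i = ys ! l" if "i \<in> I" for i
    using that ys len by (metis in_set_conv_nth)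
  have delta: "(\<Sum>m = 0..<n. P $$ (l, m) * D $$ (m, k)) = P $$ (l, k) * D $$ (k, k)"
    if "k < n" for l k
    using that diag by (subst sum.remove[of _ k]) (auto intro!: sum.neutral)
  have 1: "(\<Sum>v\<in>A. G i v * F j v) = (if i = j then 1 else 0)" if mem: "i \<in> I" "j \<in> I" for i j
  proof -
    obtain k l where kl: "k < n" "l < n" "i = ys ! k" "j = ys ! l"
      using exI[OF mem(1)] exI[OF mem(2)] by blast
    then show ?thesis
      using arg_cong[OF QP, of "\<lambda>M. M $$ (k, l)"] carr ys len
      by (simp add: sumA F_def G_def row col scalar_prod_def nth_eq_iff_index_eq)
  qed
  have 2: "(\<Sum>i\<in>I. F i u * G i v) = (if u = v then 1 else 0)" if mem: "u \<in> A" "v \<in> A" for u v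
  proof -
    obtain k l where kl: "k < n" "l < n" "u = xs ! k" "v = xs ! l"
      using exA[OF mem(1)] exA[OF mem(2)] by blast
    then show ?thesis
      using arg_cong[OF PQ, of "\<lambda>M. M $$ (k, l)"] carr xs len
      by (simp add: sumI F_def G_def row col scalar_prod_def nth_eq_iff_index_eq)
  qed
  have 3: "(\<Sum>v\<in>A. M u v * F i v) = lam i * F i u" if mem: "i \<in> I" "u \<in> A" for i u
  proof -
    obtain k l where kl: "k < n" "l < n" "i = ys ! k" "u = xs ! l"
      using exI[OF mem(1)] exA[OF mem(2)] by blast
    then show ?thesis
      using arg_cong[OF CP, of "\<lambda>M. M $$ (l, k)"] carr
      by (simp add: sumA F_def row col scalar_prod_def delta Dkk Cm)
  qed
  show ?thesis
    unfolding eigensystem_def using 1 2 3 by blast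
qed

lemma eigensystem_const_minus:
  assumes "finite A" "eigensystem A M I lam F G"
  shows "eigensystem A (\<lambda>u v. (if u = v then c else 0) - M u v) I (\<lambda>i. c - lam i) F G"
proof -
  have "(\<Sum>v\<in>A. ((if u = v then c else 0) - M u v) * F i v) = c * F i u - (\<Sum>v\<in>A. M u v * F i v)"
    if "u \<in> A" for u i
  proof -
    have "(\<Sum>v\<in>A. (if u = v then c else 0) * F i v) = (\<Sum>v\<in>A. if v = u then c * F i u else 0)"
      by (intro sum.cong) auto
    then show ?thesis
      using assms(1) that by (simp add: left_diff_distrib sum_subtractf)
  qed
  then show ?thesis
    using assms(2) unfolding eigensystem_def by (simp add: left_diff_distrib)
qed

section \<open>Tensor products of eigenfunctions\<close>

lemma prod_indicator_PiE:
  assumes "finite K" "i \<in> Pi\<^sub>E K I" "j \<in> Pi\<^sub>E K I"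
  shows "(\<Prod>k\<in>K. if i k = j k then 1 else 0 :: real) = (if i = j then 1 else 0)"
proof (cases "i = j")
  case False
  then obtain k where "k \<in> K" "i k \<noteq> j k"
    using PiE_ext[OF assms(2,3)] by blast
  then show ?thesis
    using False assms(1) by (simp add: prod_zero_iff) blast
qed simp

text \<open>\<open>M'\<close> is the Kronecker sum of the \<open>M k\<close>, given through its
  action on functions so that its entries need no case distinction. Both duality relations factor
  over the coordinates because a product of sums is a sum over tuples. In the eigenvalue equation
  each summand of \<open>M'\<close> moves a single coordinate and contributes the eigenvalue of that
  factor.\<close>

lemma eigensystem_PiE:
  assumes K: "finite K" and fin: "\<And>k. k \<in> K \<Longrightarrow> finite (A k)" "\<And>k. k \<in> K \<Longrightarrow> finite (I k)"
    and es: "\<And>k. k \<in> K \<Longrightarrow> eigensystem (A k) (M k) (I k) (lam k) (F k) (G k)"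
    and M': "\<And>f u. u \<in> Pi\<^sub>E K A \<Longrightarrow>
      (\<Sum>v\<in>Pi\<^sub>E K A. M' u v * f v) = (\<Sum>k\<in>K. \<Sum>w\<in>A k. M k (u k) w * f (u(k := w)))"
  shows "eigensystem (Pi\<^sub>E K A) M' (Pi\<^sub>E K I) (\<lambda>j. \<Sum>k\<in>K. lam k (j k))
    (\<lambda>j u. \<Prod>k\<in>K. F k (j k) (u k)) (\<lambda>j u. \<Prod>k\<in>K. G k (j k) (u k))"
proof -
  have 1: "(\<Sum>v\<in>Pi\<^sub>E K A. (\<Prod>k\<in>K. G k (i k) (v k)) * (\<Prod>k\<in>K. F k (j k) (v k))) = (if i = j then 1 else 0)"
    if i: "i \<in> Pi\<^sub>E K I" and j: "j \<in> Pi\<^sub>E K I" for i j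
  proof -
    have "(\<Sum>v\<in>Pi\<^sub>E K A. (\<Prod>k\<in>K. G k (i k) (v k)) * (\<Prod>k\<in>K. F k (j k) (v k)))
        = (\<Prod>k\<in>K. \<Sum>w\<in>A k. G k (i k) w * F k (j k) w)"
      using K fin(1) by (simp add: prod_sum_PiE prod.distrib)
    also have "\<dots> = (\<Prod>k\<in>K. if i k = j k then 1 else 0)"
      using eigensystemD(1)[OF es] PiE_mem[OF i] PiE_mem[OF j] by (intro prod.cong) simp_all
    finally show ?thesis
      using prod_indicator_PiE[OF K i j] by simp
  qed
  have 2: "(\<Sum>j\<in>Pi\<^sub>E K I. (\<Prod>k\<in>K. F k (j k) (u k)) * (\<Prod>k\<in>K. G k (j k) (v k))) = (if u = v then 1 else 0)"
    if u: "u \<in> Pi\<^sub>E K A" and v: "v \<in> Pi\<^sub>E K A" for u v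
  proof -
    have "(\<Sum>j\<in>Pi\<^sub>E K I. (\<Prod>k\<in>K. F k (j k) (u k)) * (\<Prod>k\<in>K. G k (j k) (v k)))
        = (\<Prod>k\<in>K. \<Sum>i\<in>I k. F k i (u k) * G k i (v k))"
      using K fin(2) by (simp add: prod_sum_PiE prod.distrib)
    also have "\<dots> = (\<Prod>k\<in>K. if u k = v k then 1 else 0)"
      using eigensystemD(2)[OF es] PiE_mem[OF u] PiE_mem[OF v] by (intro prod.cong) simp_all
    finally show ?thesis
      using prod_indicator_PiE[OF K u v] by simp
  qed
  have 3: "(\<Sum>v\<in>Pi\<^sub>E K A. M' u v * (\<Prod>k\<in>K. F k (j k) (v k))) =
      (\<Sum>k\<in>K. lam k (j k)) * (\<Prod>k\<in>K. F k (j k) (u k))"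
    if j: "j \<in> Pi\<^sub>E K I" and u: "u \<in> Pi\<^sub>E K A" for j u
  proof -
    have "(\<Sum>w\<in>A k. M k (u k) w * (\<Prod>l\<in>K. F l (j l) ((u(k := w)) l))) =
        lam k (j k) * (\<Prod>l\<in>K. F l (j l) (u l))" if k: "k \<in> K" for k
    proof -
      \<comment> \<open>\<open>R\<close> collects the factors that changing coordinate
        \<open>k\<close> leaves alone.\<close>
      define R where "R = (\<Prod>l\<in>K - {k}. F l (j l) (u l))"
      have split: "(\<Prod>l\<in>K. F l (j l) ((u(k := w)) l)) = F k (j k) w * R" for w
        using K k by (subst prod.remove[of _ k]) (auto simp: R_def intro!: prod.cong)
      have "(\<Sum>w\<in>A k. M k (u k) w * (\<Prod>l\<in>K. F l (j l) ((u(k := w)) l))) =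
          (\<Sum>w\<in>A k. M k (u k) w * F k (j k) w) * R"
        unfolding split by (simp add: sum_distrib_right mult.assoc)
      also have "\<dots> = lam k (j k) * (F k (j k) (u k) * R)"
        using eigensystemD(3)[OF es[OF k], of "j k" "u k"] j u k by auto
      also have "F k (j k) (u k) * R = (\<Prod>l\<in>K. F l (j l) (u l))"
        using K k by (simp add: R_def prod.remove)
      finally show ?thesis .
    qed
    then show ?thesis
      using M'[OF u, of "\<lambda>v. \<Prod>k\<in>K. F k (j k) (v k)"] by (simp add: sum_distrib_right)
  qed
  show ?thesis
    unfolding eigensystem_def using 1 2 3 by blast
qed

section \<open>The Laplacian and its behaviour under Cartesian products\<close>

definition neighbours :: "'a sgraph \<Rightarrow> 'a \<Rightarrow> 'a set" where
  "neighbours G u = {v. {u, v} \<in> edges G}"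

definition laplacian :: "'a sgraph \<Rightarrow> 'a \<Rightarrow> 'a \<Rightarrow> real" where
  "laplacian G u v = (if u = v then of_nat (degree_at G u) else 0) - of_int (adjacency G u v)"

lemma laplacian_mat_eq: "laplacian_mat G = mat_on (verts G) (laplacian G)"
  unfolding laplacian_mat_def degree_mat_def adjacency_mat_def mat_on_def mat_along_def
  by (rule eq_matI) (simp_all add: laplacian_def)

lemma laplacian_sym: "laplacian G u v = laplacian G v u"
  by (simp add: laplacian_def adjacency_def insert_commute)

lemma finite_edges: "signed_graph G \<Longrightarrow> finite (edges G)"
  unfolding signed_graph_def by (rule finite_subset[of _ "Pow (verts G)"]) auto

lemma neighbours_subset: "signed_graph G \<Longrightarrow> neighbours G u \<subseteq> verts G"
  using edge_ends(3) by (fastforce simp: neighbours_def)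

lemma finite_neighbours: "signed_graph G \<Longrightarrow> finite (neighbours G u)"
  using neighbours_subset finite_subset signed_graph_def by metis

lemma edge_cases:
  assumes "signed_graph G" "e \<in> edges G"
  obtains u v where "e = {u, v}" "u \<noteq> v"
  using assms unfolding signed_graph_def by (metis card_2_iff)

lemma degree_at_eq_card_neighbours:
  assumes "signed_graph G"
  shows "degree_at G u = card (neighbours G u)"
proof -
  have "{e \<in> edges G. u \<in> e} = (\<lambda>v. {u, v}) ` neighbours G u"
  proof
    show "{e \<in> edges G. u \<in> e} \<subseteq> (\<lambda>v. {u, v}) ` neighbours G u"
    proof
      fix e assume "e \<in> {e \<in> edges G. u \<in> e}"
      then have e: "e \<in> edges G" "u \<in> e" by auto
      obtain a b where "e = {a, b}" using edge_cases[OF assms e(1)] by blast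
      then have "\<exists>v. e = {u, v}" using e(2) by auto
      then show "e \<in> (\<lambda>v. {u, v}) ` neighbours G u"
        using e(1) by (auto simp: neighbours_def)
    qed
  qed (auto simp: neighbours_def)
  moreover have "inj_on (\<lambda>v. {u, v}) (neighbours G u)"
    by (auto simp: inj_on_def doubleton_eq_iff)
  ultimately show ?thesis
    unfolding degree_at_def by (simp add: card_image)
qed

text \<open>The degree is spread out as one copy of \<open>f u\<close> for each neighbour. In this
  form degree and adjacency pass together to a Cartesian product, whose neighbourhoods are disjoint
  unions.\<close>

lemma laplacian_action:
  assumes G: "signed_graph G" and u: "u \<in> verts G"
  shows "(\<Sum>v\<in>verts G. laplacian G u v * f v) =
    (\<Sum>v\<in>neighbours G u. f u - of_int (sig G {u, v}) * f v)"
proof -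
  have fin: "finite (verts G)"
    using G by (simp add: signed_graph_def)
  have "(\<Sum>v\<in>verts G. (if u = v then real (degree_at G u) else 0) * f v) =
      (\<Sum>v\<in>verts G. if v = u then real (degree_at G u) * f u else 0)"
    by (intro sum.cong) auto
  then have 1: "(\<Sum>v\<in>verts G. (if u = v then real (degree_at G u) else 0) * f v) =
      (\<Sum>v\<in>neighbours G u. f u)"
    using fin u degree_at_eq_card_neighbours[OF G] by simp
  have 2: "(\<Sum>v\<in>verts G. of_int (adjacency G u v) * f v) =
      (\<Sum>v\<in>neighbours G u. of_int (sig G {u, v}) * f v)"
    using neighbours_subset[OF G] fin
    by (intro sum.mono_neutral_cong_right) (auto simp: adjacency_def neighbours_def)
  show ?thesis
    unfolding laplacian_def left_diff_distrib sum_subtractf 1 2 ..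
qed

text \<open>On the diagonal the squares of the entries count incident edges; off the diagonal only
  the edge \<open>{u, v}\<close> contains both ends, and the sign rule for incidence matrices gives
  its contribution.\<close>

lemma incidence_gram:
  assumes G: "signed_graph G" and H: "incidence_matrix G H"
    and uv: "u \<in> verts G" "v \<in> verts G"
  shows "(\<Sum>e\<in>edges G. real_of_int (H u e) * real_of_int (H v e)) = laplacian G u v"
proof (cases "u = v")
  case True
  have "real_of_int (H u e) * real_of_int (H u e) = (if u \<in> e then 1 else 0)" if "e \<in> edges G" for e
    using H uv(1) that unfolding incidence_matrix_def by (force split: if_splits)
  then have "(\<Sum>e\<in>edges G. real_of_int (H u e) * real_of_int (H u e)) =
      (\<Sum>e\<in>edges G. if u \<in> e then 1 else 0)"
    by (intro sum.cong) auto
  also have "\<dots> = real (degree_at G u)"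
    using finite_edges[OF G] by (simp add: degree_at_def sum.If_cases Int_def conj_commute)
  \<comment> \<open>The diagonal of the adjacency looks up \<open>{u, u} = {u}\<close>, which is no
    edge of a loop-free graph.\<close>
  moreover have "{u} \<notin> edges G"
    using edge_ends(1)[OF G, of u u] by auto
  ultimately show ?thesis
    using True by (simp add: laplacian_def adjacency_def)
next
  case False
  have z: "real_of_int (H u e) * real_of_int (H v e) = 0" if e: "e \<in> edges G" "e \<noteq> {u, v}" for e
  proof -
    have "\<not> (u \<in> e \<and> v \<in> e)"
      using edge_cases[OF G e(1)] e(2) False by (metis doubleton_eq_iff insertE singletonD)
    then show ?thesis
      using H uv e(1) unfolding incidence_matrix_def by auto
  qed
  have "(\<Sum>e\<in>edges G. real_of_int (H u e) * real_of_int (H v e)) =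
      (\<Sum>e\<in>edges G. if e = {u, v} then - real_of_int (sig G {u, v}) else 0)"
  proof (rule sum.cong)
    fix e assume e: "e \<in> edges G"
    show "real_of_int (H u e) * real_of_int (H v e) =
        (if e = {u, v} then - real_of_int (sig G {u, v}) else 0)"
    proof (cases "e = {u, v}")
      case True
      then have "H u e * H v e = - sig G {u, v}"
        using H e unfolding incidence_matrix_def by blast
      then show ?thesis
        using True by (metis of_int_minus of_int_mult)
    qed (use z e in simp)
  qed simp
  also have "\<dots> = - real_of_int (adjacency G u v)"
    using finite_edges[OF G] by (simp add: adjacency_def)
  finally show ?thesis
    using False by (simp add: laplacian_def)
qed

text \<open>The sum of squares yields nonnegativity of the eigenvalues and, since it vanishes only
  term by term, an edgewise description of the kernel.\<close>

lemma laplacian_quadratic_form: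
  assumes G: "signed_graph G" and H: "incidence_matrix G H"
  shows "(\<Sum>u\<in>verts G. f u * (\<Sum>v\<in>verts G. laplacian G u v * f v)) =
    (\<Sum>e\<in>edges G. (\<Sum>v\<in>verts G. real_of_int (H v e) * f v)\<^sup>2)"
proof -
  let ?h = "\<lambda>v e. real_of_int (H v e)"
  have "(\<Sum>u\<in>verts G. f u * (\<Sum>v\<in>verts G. laplacian G u v * f v)) =
      (\<Sum>u\<in>verts G. \<Sum>v\<in>verts G. \<Sum>e\<in>edges G. (?h u e * f u) * (?h v e * f v))"
    using incidence_gram[OF G H, symmetric]
    by (simp add: sum_distrib_left sum_distrib_right ac_simps)
  also have "\<dots> = (\<Sum>u\<in>verts G. \<Sum>e\<in>edges G. \<Sum>v\<in>verts G. (?h u e * f u) * (?h v e * f v))"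
    by (intro sum.cong refl sum.swap)
  also have "\<dots> = (\<Sum>e\<in>edges G. \<Sum>u\<in>verts G. \<Sum>v\<in>verts G. (?h u e * f u) * (?h v e * f v))"
    by (rule sum.swap)
  also have "\<dots> = (\<Sum>e\<in>edges G. (\<Sum>v\<in>verts G. ?h v e * f v)\<^sup>2)"
    by (simp add: power2_eq_square sum_product)
  finally show ?thesis .
qed

lemma laplacian_eigenvalue_nonneg:
  assumes G: "signed_graph G" and es: "eigensystem (verts G) (laplacian G) I lam F F'" and i: "i \<in> I"
  shows "0 \<le> lam i"
proof -
  obtain H where H: "incidence_matrix G H"
    using ex_incidence_matrix[OF G] by blast
  \<comment> \<open>Duality excludes the zero function, so dividing by the norm of
    \<open>F i\<close> is legitimate.\<close>
  have "(\<Sum>u\<in>verts G. F' i u * F i u) = 1"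
    using eigensystemD(1)[OF es i i] by simp
  then obtain u where u: "u \<in> verts G" "F i u \<noteq> 0"
    by (metis (no_types, lifting) mult_zero_right sum.neutral zero_neq_one)
  have "0 < (\<Sum>u\<in>verts G. (F i u)\<^sup>2)"
    using G u by (intro sum_pos2[of _ u]) (auto simp: signed_graph_def)
  moreover have "0 \<le> (\<Sum>u\<in>verts G. F i u * (\<Sum>v\<in>verts G. laplacian G u v * F i v))"
    unfolding laplacian_quadratic_form[OF G H] by (intro sum_nonneg) auto
  moreover have "(\<Sum>u\<in>verts G. F i u * (\<Sum>v\<in>verts G. laplacian G u v * F i v)) =
      lam i * (\<Sum>u\<in>verts G. (F i u)\<^sup>2)"
    unfolding sum_distrib_left[of "lam i"]
    using eigensystemD(3)[OF es i] by (intro sum.cong) (simp_all add: power2_eq_square)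
  ultimately show ?thesis
    by (simp add: zero_le_mult_iff)
qed

text \<open>The quadratic form vanishes at \<open>f\<close>, hence so does its term for the edge, a
  linear relation between the values at the two ends. Multiplying it by the entry
  \<open>H u {u, v}\<close>, whose square is 1, replaces the incidence entries by the sign.\<close>

lemma laplacian_kernel_edge:
  assumes G: "signed_graph G"
    and f: "\<And>u. u \<in> verts G \<Longrightarrow> (\<Sum>v\<in>verts G. laplacian G u v * f v) = 0"
    and uv: "{u, v} \<in> edges G"
  shows "f u = real_of_int (sig G {u, v}) * f v"
proof -
  obtain H where H: "incidence_matrix G H"
    using ex_incidence_matrix[OF G] by blast
  let ?e = "{u, v}"
  note ends = edge_ends[OF G uv]
  have fin: "finite (verts G)"
    using G by (simp add: signed_graph_def)
  have "(\<Sum>e\<in>edges G. (\<Sum>v\<in>verts G. real_of_int (H v e) * f v)\<^sup>2) = 0"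
    unfolding laplacian_quadratic_form[OF G H, symmetric] using f by simp
  then have "(\<Sum>w\<in>verts G. real_of_int (H w ?e) * f w) = 0"
    using uv finite_edges[OF G] by (subst (asm) sum_nonneg_eq_0_iff) auto
  moreover have "(\<Sum>w\<in>verts G. real_of_int (H w ?e) * f w) = (\<Sum>w\<in>?e. real_of_int (H w ?e) * f w)"
    using fin ends H uv unfolding incidence_matrix_def
    by (intro sum.mono_neutral_right) auto
  ultimately have 0: "real_of_int (H u ?e) * f u + real_of_int (H v ?e) * f v = 0"
    using ends by simp
  have "H u ?e \<in> {1, -1}"
    using H uv ends unfolding incidence_matrix_def by (auto dest!: bspec[of _ _ u])
  then have sq: "real_of_int (H u ?e) * real_of_int (H u ?e) = 1"
    by auto
  have prod: "real_of_int (H u ?e) * real_of_int (H v ?e) = - real_of_int (sig G ?e)"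
    using H uv unfolding incidence_matrix_def by (metis of_int_minus of_int_mult)
  have "real_of_int (H u ?e) * (real_of_int (H u ?e) * f u + real_of_int (H v ?e) * f v) = 0"
    using 0 by simp
  then have "(real_of_int (H u ?e) * real_of_int (H u ?e)) * f u +
      (real_of_int (H u ?e) * real_of_int (H v ?e)) * f v = 0"
    by (simp add: algebra_simps)
  then show ?thesis
    unfolding sq prod by simp
qed

lemma degree_sum:
  assumes G: "signed_graph G"
  shows "(\<Sum>v\<in>verts G. degree_at G v) = 2 * card (edges G)"
proof -
  have fin: "finite (verts G)"
    using G by (simp add: signed_graph_def)
  have "(\<Sum>v\<in>verts G. degree_at G v) = (\<Sum>v\<in>verts G. \<Sum>e\<in>edges G. if v \<in> e then 1 else 0)"
    using finite_edges[OF G] by (simp add: degree_at_def sum.If_cases Int_def conj_commute)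
  also have "\<dots> = (\<Sum>e\<in>edges G. \<Sum>v\<in>verts G. if v \<in> e then 1 else 0)"
    by (rule sum.swap)
  also have "\<dots> = (\<Sum>e\<in>edges G. 2)"
  proof (rule sum.cong)
    fix e assume "e \<in> edges G"
    then have "verts G \<inter> e = e" "card e = 2"
      using G unfolding signed_graph_def by auto
    then show "(\<Sum>v\<in>verts G. if v \<in> e then 1 else 0 :: nat) = 2"
      using fin by (simp add: sum.If_cases)
  qed simp
  finally show ?thesis
    by simp
qed

section \<open>Neighbourhoods, Laplacian and degrees of a Cartesian product\<close>

text \<open>Loop-freeness makes this injective: a neighbour \<open>w\<close> differs from
  \<open>u k\<close>, so the altered coordinate can be recovered from the altered tuple.\<close>

lemma neighbours_cart_prod:
  assumes K: "finite K" and S: "\<And>k. k \<in> K \<Longrightarrow> signed_graph (S k)"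
    and u: "u \<in> verts (cart_prod K S)"
  shows "bij_betw (\<lambda>(k, w). u(k := w)) (SIGMA k:K. neighbours (S k) (u k))
    (neighbours (cart_prod K S) u)"
proof -
  have u': "u \<in> (\<Pi>\<^sub>E k\<in>K. verts (S k))"
    using u by (simp add: cart_prod_def)
  have ne: "w \<noteq> u k" if "k \<in> K" "w \<in> neighbours (S k) (u k)" for k w
    using edge_ends(1)[OF S] that unfolding neighbours_def by blast
  show ?thesis
    unfolding bij_betw_def
  proof
    show "inj_on (\<lambda>(k, w). u(k := w)) (SIGMA k:K. neighbours (S k) (u k))"
    proof (rule inj_onI, clarify)
      fix k w k' w'
      assume a: "k \<in> K" "w \<in> neighbours (S k) (u k)" "k' \<in> K" "w' \<in> neighbours (S k') (u k')"
        and eq: "u(k := w) = u(k' := w')"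
      show "k = k' \<and> w = w'"
        using fun_cong[OF eq, of k] ne[OF a(1,2)] by (auto split: if_splits)
    qed
    show "(\<lambda>(k, w). u(k := w)) ` (SIGMA k:K. neighbours (S k) (u k)) = neighbours (cart_prod K S) u"
    proof (intro equalityI subsetI)
      fix v assume "v \<in> (\<lambda>(k, w). u(k := w)) ` (SIGMA k:K. neighbours (S k) (u k))"
      then obtain k w where k: "k \<in> K" "{u k, w} \<in> edges (S k)" "v = u(k := w)"
        by (auto simp: neighbours_def)
      have "v \<in> (\<Pi>\<^sub>E k\<in>K. verts (S k))"
        unfolding k(3) using edge_ends(3)[OF S k(2)] k(1) u' by (auto simp: PiE_iff extensional_def)
      moreover have "\<exists>i\<in>K. {u i, v i} \<in> edges (S i) \<and> (\<forall>j\<in>K - {i}. u j = v j)"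
        using k by (intro bexI[of _ k]) auto
      ultimately have "{u, v} \<in> edges (cart_prod K S)"
        unfolding cart_prod_def using u' by auto
      then show "v \<in> neighbours (cart_prod K S) u"
        by (simp add: neighbours_def)
    next
      fix v assume "v \<in> neighbours (cart_prod K S) u"
      then obtain u1 v1 k where *: "{u, v} = {u1, v1}" "u1 \<in> (\<Pi>\<^sub>E k\<in>K. verts (S k))"
        "v1 \<in> (\<Pi>\<^sub>E k\<in>K. verts (S k))" "k \<in> K" "{u1 k, v1 k} \<in> edges (S k)"
        "\<forall>j\<in>K - {k}. u1 j = v1 j"
        unfolding neighbours_def cart_prod_def by auto
      then have v: "v \<in> (\<Pi>\<^sub>E k\<in>K. verts (S k))" "{u k, v k} \<in> edges (S k)" "\<forall>j\<in>K - {k}. u j = v j"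
      proof -
        \<comment> \<open>An edge is unordered, so \<open>u\<close> may be either of the two tuples
          that witness it.\<close>
        from *(1) consider "u = u1" "v = v1" | "u = v1" "v = u1"
          by (auto simp: doubleton_eq_iff)
        then show "v \<in> (\<Pi>\<^sub>E k\<in>K. verts (S k))" "{u k, v k} \<in> edges (S k)"
            "\<forall>j\<in>K - {k}. u j = v j"
          using *(2,3,5,6) by (metis insert_commute)+
      qed
      have "v = u(k := v k)"
      proof
        fix j show "v j = (u(k := v k)) j"
          using v(1,3) u' by (cases "j \<in> K") (auto simp: PiE_iff extensional_def)
      qed
      then show "v \<in> (\<lambda>(k, w). u(k := w)) ` (SIGMA k:K. neighbours (S k) (u k))"
        using *(4) v(2) by (auto simp: neighbours_def intro!: image_eqI[of _ _ "(k, v k)"])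
    qed
  qed
qed

lemma sum_neighbours_cart_prod:
  assumes K: "finite K" and S: "\<And>k. k \<in> K \<Longrightarrow> signed_graph (S k)"
    and u: "u \<in> verts (cart_prod K S)"
  shows "(\<Sum>v\<in>neighbours (cart_prod K S) u. g v) =
    (\<Sum>k\<in>K. \<Sum>w\<in>neighbours (S k) (u k). g (u(k := w)))"
  using sum.reindex_bij_betw[OF neighbours_cart_prod[OF assms], of g] K finite_neighbours[OF S]
  by (simp add: sum.Sigma case_prod_unfold)

lemma degree_at_cart_prod:
  assumes K: "finite K" and S: "\<And>k. k \<in> K \<Longrightarrow> signed_graph (S k)"
    and u: "u \<in> verts (cart_prod K S)"
  shows "degree_at (cart_prod K S) u = (\<Sum>k\<in>K. degree_at (S k) (u k))"
  using sum_neighbours_cart_prod[OF assms, of "\<lambda>_. 1 :: nat"]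
  by (simp add: degree_at_eq_card_neighbours S signed_graph_cart_prod K)

lemma laplacian_cart_prod:
  assumes K: "finite K" and S: "\<And>k. k \<in> K \<Longrightarrow> signed_graph (S k)"
    and u: "u \<in> verts (cart_prod K S)"
  shows "(\<Sum>v\<in>verts (cart_prod K S). laplacian (cart_prod K S) u v * f v) =
    (\<Sum>k\<in>K. \<Sum>w\<in>verts (S k). laplacian (S k) (u k) w * f (u(k := w)))"
proof -
  have uk: "u k \<in> verts (S k)" if "k \<in> K" for k
    using u that by (auto simp: cart_prod_def)
  have sg: "sig (cart_prod K S) {u, u(k := w)} = sig (S k) {u k, w}"
    if "k \<in> K" "w \<in> neighbours (S k) (u k)" for k w
    using sig_cart_prod[of K S k u "u(k := w)"] S that by (simp add: neighbours_def)
  have "(\<Sum>v\<in>verts (cart_prod K S). laplacian (cart_prod K S) u v * f v) =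
      (\<Sum>k\<in>K. \<Sum>w\<in>neighbours (S k) (u k).
         f u - real_of_int (sig (cart_prod K S) {u, u(k := w)}) * f (u(k := w)))"
    using laplacian_action[OF signed_graph_cart_prod[OF K S] u, of f]
      sum_neighbours_cart_prod[OF K S u, where g =
        "\<lambda>v. f u - real_of_int (sig (cart_prod K S) {u, v}) * f v"]
    by simp
  also have "\<dots> = (\<Sum>k\<in>K. \<Sum>w\<in>verts (S k). laplacian (S k) (u k) w * f (u(k := w)))"
  proof (rule sum.cong[OF refl])
    fix k assume k: "k \<in> K"
    show "(\<Sum>w\<in>neighbours (S k) (u k).
          f u - real_of_int (sig (cart_prod K S) {u, u(k := w)}) * f (u(k := w))) =
        (\<Sum>w\<in>verts (S k). laplacian (S k) (u k) w * f (u(k := w)))"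
      using laplacian_action[OF S[OF k] uk[OF k], where f = "\<lambda>w. f (u(k := w))"] sg[OF k] by simp
  qed
  finally show ?thesis .
qed

lemma sum_PiE_component:
  fixes g :: "'a \<Rightarrow> 'b :: comm_semiring_1"
  assumes "finite K" "\<And>l. l \<in> K \<Longrightarrow> finite (A l)" "k \<in> K"
  shows "(\<Sum>u\<in>Pi\<^sub>E K A. g (u k)) = (\<Sum>w\<in>A k. g w) * of_nat (\<Prod>l\<in>K - {k}. card (A l))"
proof -
  \<comment> \<open>Padding with factors 1 in the other coordinates lets the sum over tuples
    factor.\<close>
  have "(\<Sum>u\<in>Pi\<^sub>E K A. g (u k)) = (\<Sum>u\<in>Pi\<^sub>E K A. \<Prod>l\<in>K. if l = k then g (u l) else 1)"
    using assms by (intro sum.cong) auto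
  also have "\<dots> = (\<Prod>l\<in>K. \<Sum>w\<in>A l. if l = k then g w else 1)"
    by (rule prod_sum_PiE[symmetric]) (use assms in auto)
  also have "\<dots> = (\<Sum>w\<in>A k. g w) * (\<Prod>l\<in>K - {k}. of_nat (card (A l)))"
    using assms by (subst prod.remove[of _ k]) (auto intro!: prod.cong)
  finally show ?thesis
    by simp
qed

text \<open>Edges are counted through the degree sum, since degrees add up at each tuple. A null
  factor would make the product null and its average degree 0 by division by zero, whatever the
  other factors are.\<close>

lemma average_degree_cart_prod:
  assumes K: "finite K" and S: "\<And>k. k \<in> K \<Longrightarrow> signed_graph (S k)"
    and ne: "\<And>k. k \<in> K \<Longrightarrow> verts (S k) \<noteq> {}"
  shows "average_degree (cart_prod K S) = (\<Sum>k\<in>K. average_degree (S k))"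
proof -
  let ?P = "cart_prod K S"
  have V: "verts ?P = (\<Pi>\<^sub>E k\<in>K. verts (S k))"
    by (simp add: cart_prod_def)
  have fin: "finite (verts (S k))" if "k \<in> K" for k
    using S[OF that] by (simp add: signed_graph_def)
  have n: "card (verts ?P) = (\<Prod>k\<in>K. card (verts (S k)))"
    unfolding V by (rule card_PiE[OF K])
  have pos: "card (verts (S k)) > 0" if "k \<in> K" for k
    using fin ne that by (simp add: card_gt_0_iff)
  have "2 * card (edges ?P) = (\<Sum>u\<in>verts ?P. \<Sum>k\<in>K. degree_at (S k) (u k))"
    using degree_sum[OF signed_graph_cart_prod[OF K S]] degree_at_cart_prod[OF K S] by simp
  also have "\<dots> = (\<Sum>k\<in>K. \<Sum>u\<in>verts ?P. degree_at (S k) (u k))"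
    by (rule sum.swap)
  also have "\<dots> = (\<Sum>k\<in>K. 2 * card (edges (S k)) * (\<Prod>l\<in>K - {k}. card (verts (S l))))"
    unfolding V using K fin by (intro sum.cong) (simp_all add: sum_PiE_component degree_sum S)
  finally have "real (2 * card (edges ?P)) =
      (\<Sum>k\<in>K. 2 * real (card (edges (S k))) * real (\<Prod>l\<in>K - {k}. card (verts (S l))))"
    by simp
  also have "\<dots> = (\<Sum>k\<in>K. average_degree (S k) * real (card (verts ?P)))"
  proof (rule sum.cong)
    fix k assume k: "k \<in> K"
    have "card (verts ?P) = card (verts (S k)) * (\<Prod>l\<in>K - {k}. card (verts (S l)))"
      unfolding n using K k by (rule prod.remove)
    then show "2 * real (card (edges (S k))) * real (\<Prod>l\<in>K - {k}. card (verts (S l))) =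
        average_degree (S k) * real (card (verts ?P))"
      using pos[OF k] by (simp add: average_degree_def)
  qed simp
  finally have "real (2 * card (edges ?P)) = (\<Sum>k\<in>K. average_degree (S k)) * real (card (verts ?P))"
    by (simp add: sum_distrib_right)
  moreover have "real (card (verts ?P)) \<noteq> 0"
    unfolding n using pos K by (simp add: prod_zero_iff)
  ultimately show ?thesis
    by (simp add: average_degree_def field_simps)
qed

section \<open>Balance and the kernel of the Laplacian\<close>

fun walk :: "'a sgraph \<Rightarrow> 'a list \<Rightarrow> bool" where
  "walk G (x # y # xs) \<longleftrightarrow> {x, y} \<in> edges G \<and> walk G (y # xs)"
| "walk G _ \<longleftrightarrow> True"

fun walk_sign :: "'a sgraph \<Rightarrow> 'a list \<Rightarrow> int" where
  "walk_sign G (x # y # xs) = sig G {x, y} * walk_sign G (y # xs)"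
| "walk_sign G _ = 1"

lemma walk_append: "walk G (xs @ y # ys) \<longleftrightarrow> walk G (xs @ [y]) \<and> walk G (y # ys)"
  by (induction G xs rule: walk.induct) simp_all

lemma walk_sign_append: "walk_sign G (xs @ y # ys) = walk_sign G (xs @ [y]) * walk_sign G (y # ys)"
  by (induction G xs rule: walk.induct) auto

lemma walk_rev: "walk G (rev xs) \<longleftrightarrow> walk G xs"
  by (induction G xs rule: walk.induct) (auto simp: walk_append[of _ _ _ "[_]"] insert_commute)

lemma walk_sign_rev: "walk_sign G (rev xs) = walk_sign G xs"
  by (induction G xs rule: walk.induct) (auto simp: walk_sign_append[of _ _ _ "[_]"] insert_commute)

lemma walk_iff_nth: "walk G xs \<longleftrightarrow> (\<forall>i. Suc i < length xs \<longrightarrow> {xs ! i, xs ! Suc i} \<in> edges G)"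
  by (induction G xs rule: walk.induct) (auto simp: nth_Cons split: nat.splits)

lemma walk_sign_eq_prod: "walk_sign G xs = (\<Prod>i<length xs - 1. sig G {xs ! i, xs ! Suc i})"
  by (induction G xs rule: walk.induct) (simp_all add: prod.lessThan_Suc_shift del: prod.lessThan_Suc)

lemma closed_list_nth:
  assumes "i < length xs"
  shows "(xs @ [hd xs]) ! i = xs ! i" "(xs @ [hd xs]) ! Suc i = xs ! (Suc i mod length xs)"
proof -
  show "(xs @ [hd xs]) ! i = xs ! i"
    using assms by (simp add: nth_append)
  show "(xs @ [hd xs]) ! Suc i = xs ! (Suc i mod length xs)"
  proof (cases "Suc i = length xs")
    case True
    then show ?thesis
      using assms by (cases xs) (simp_all add: nth_append)
  next
    case False
    then show ?thesis
      using assms by (simp add: nth_append)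
  qed
qed

text \<open>Repeating the head at the end replaces the cyclic indices by a plain list, which can be
  cut and reversed.\<close>

lemma is_cycle_iff_walk:
  "is_cycle G xs \<longleftrightarrow> length xs \<ge> 3 \<and> distinct xs \<and> walk G (xs @ [hd xs])"
  by (simp add: is_cycle_def walk_iff_nth closed_list_nth del: nth_append)

lemma cycle_sign_eq_walk_sign: "cycle_sign G xs = walk_sign G (xs @ [hd xs])"
  by (simp add: cycle_sign_def walk_sign_eq_prod closed_list_nth)

lemma sig_square: "signed_graph G \<Longrightarrow> e \<in> edges G \<Longrightarrow> sig G e * sig G e = 1"
  unfolding signed_graph_def by fastforce

lemma walk_sign_square: "signed_graph G \<Longrightarrow> walk G xs \<Longrightarrow> walk_sign G xs * walk_sign G xs = 1"
  by (induction G xs rule: walk.induct) (auto simp: sig_square mult.assoc mult.left_commute)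

text \<open>A closed walk that is not a cycle splits at a repeated vertex into two shorter ones.\<close>

lemma balanced_closed_walk:
  assumes G: "signed_graph G" and bal: "balanced G"
  shows "xs \<noteq> [] \<Longrightarrow> walk G (xs @ [hd xs]) \<Longrightarrow> walk_sign G (xs @ [hd xs]) = 1"
proof (induction xs rule: length_induct)
  case (1 xs)
  show ?case
  proof (cases "distinct xs")
    case False
    then obtain as bs cs y where xs: "xs = as @ y # bs @ y # cs"
      using not_distinct_decomp by force
    \<comment> \<open>Cutting out the loop at \<open>y\<close> keeps the base point, also when
      \<open>as\<close> is empty and \<open>y\<close> itself is the base point.\<close>
    have h: "hd (as @ y # cs) = hd xs"
      unfolding xs by (cases as) auto
    have split: "xs @ [hd xs] = as @ y # (bs @ y # (cs @ [hd xs]))"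
      unfolding xs by simp
    have w: "walk G (as @ [y])" "walk G ((y # bs) @ [y])" "walk G (y # (cs @ [hd xs]))"
      using 1(3) walk_append[of G as y "bs @ y # cs @ [hd xs]"]
        walk_append[of G "y # bs" y "cs @ [hd xs]"]
      unfolding split by simp_all
    have "walk_sign G ((y # bs) @ [hd (y # bs)]) = 1"
      using 1(1)[rule_format, of "y # bs"] w(2) xs by simp
    moreover have "walk G ((as @ y # cs) @ [hd (as @ y # cs)])"
      using w(1,3) walk_append[of G as y "cs @ [hd xs]"] unfolding h by simp
    then have "walk_sign G ((as @ y # cs) @ [hd (as @ y # cs)]) = 1"
      using 1(1)[rule_format, of "as @ y # cs"] xs by simp
    ultimately show ?thesis
      using walk_sign_append[of G as y "bs @ y # cs @ [hd xs]"]
        walk_sign_append[of G "y # bs" y "cs @ [hd xs]"] walk_sign_append[of G as y "cs @ [hd xs]"]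
      unfolding h unfolding split by simp
  next
    case True
    show ?thesis
    proof (cases "length xs \<ge> 3")
      case True
      then show ?thesis
        using bal \<open>distinct xs\<close> 1(3) unfolding balanced_def
        by (metis is_cycle_iff_walk cycle_sign_eq_walk_sign)
    next
      \<comment> \<open>A single vertex would close up through a loop, and two vertices traverse one
        edge back and forth, with sign a square.\<close>
      case False
      then consider x where "xs = [x]" | x y where "xs = [x, y]"
        using 1(2) by (cases xs rule: remdups_adj.cases) (auto simp: Suc_le_eq)
      then show ?thesis
      proof cases
        case 1
        then show ?thesis
          using \<open>walk G (xs @ [hd xs])\<close> edge_ends(1)[OF G, of x x] by auto
      next
        case 2
        then show ?thesis
          using \<open>walk G (xs @ [hd xs])\<close> sig_square[OF G, of "{x, y}"] by (simp add: insert_commute)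
      qed
    qed
  qed
qed

section \<open>Balance as existence of a switching\<close>

text \<open>\<open>s v\<close> is the sign of an arbitrarily chosen walk from the root
  \<open>r\<close> to \<open>v\<close>. An edge between \<open>u\<close> and \<open>v\<close> closes
  the two chosen walks to a closed walk, whose sign is 1 by balance.\<close>

lemma balanced_ex_switching:
  assumes G: "signed_graph G" and bal: "balanced G"
    and conn: "\<And>v. v \<in> verts G \<Longrightarrow> \<exists>xs. walk G (r # xs) \<and> last (r # xs) = v"
  shows "\<exists>s. (\<forall>v\<in>verts G. s v * s v = 1) \<and> (\<forall>u v. {u, v} \<in> edges G \<longrightarrow> sig G {u, v} = s u * s v)"
proof -
  obtain p where p: "\<And>v. v \<in> verts G \<Longrightarrow> walk G (r # p v) \<and> last (r # p v) = v"
    using conn by metis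
  define s where "s v = walk_sign G (r # p v)" for v
  have sq: "s v * s v = 1" if "v \<in> verts G" for v
    using walk_sign_square[OF G] p[OF that] unfolding s_def by blast
  have "sig G {u, v} = s u * s v" if e: "{u, v} \<in> edges G" for u v
  proof -
    have uv: "u \<in> verts G" "v \<in> verts G"
      using edge_ends[OF G e] by auto
    obtain us vs where us: "r # p u = us @ [u]" and vs: "r # p v = vs @ [v]"
      using p uv by (metis append_butlast_last_id list.distinct(1))
    have r: "rev (vs @ [v]) = rev (p v) @ [r]"
      unfolding vs[symmetric] by simp
    \<comment> \<open>The closed walk runs from \<open>r\<close> to \<open>u\<close>, over the edge
      to \<open>v\<close> and back to \<open>r\<close>; its list without the final \<open>r\<close>
      is \<open>r # p u @ rev (p v)\<close>.\<close>
    have cl: "(r # p u @ rev (p v)) @ [hd (r # p u @ rev (p v))] = us @ u # rev (vs @ [v])"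
      unfolding r using us by simp
    have "walk G (us @ u # rev (vs @ [v]))"
      using p[OF uv(1)] p[OF uv(2)] e walk_rev[of G "vs @ [v]"] unfolding us vs
      by (subst walk_append) simp
    then have "walk_sign G (us @ u # rev (vs @ [v])) = 1"
      using balanced_closed_walk[OF G bal, of "r # p u @ rev (p v)"] unfolding cl by simp
    moreover have "walk_sign G (us @ u # rev (vs @ [v])) = s u * (sig G {u, v} * s v)"
      using walk_sign_rev[of G "vs @ [v]"] unfolding s_def us vs
      by (subst walk_sign_append) simp
    ultimately have "s u * (sig G {u, v} * s v) = 1"
      by simp
    then have "(s u * s u) * sig G {u, v} * (s v * s v) = s u * s v"
      by (metis mult.assoc mult.commute mult.right_neutral)
    then show ?thesis
      using sq uv by simp
  qed
  then show ?thesis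
    using sq by blast
qed

text \<open>Each interior vertex enters twice and cancels; on a closed walk the two ends cancel as
  well, which gives balance.\<close>

lemma walk_sign_switching:
  assumes "\<And>v. s v * s v = (1 :: int)" "\<And>u v. {u, v} \<in> edges G \<Longrightarrow> sig G {u, v} = s u * s v"
  shows "xs \<noteq> [] \<Longrightarrow> walk G xs \<Longrightarrow> walk_sign G xs = s (hd xs) * s (last xs)"
proof (induction xs rule: induct_list012)
  case (3 x y xs)
  then have "walk_sign G (x # y # xs) = s x * (s y * s y) * s (last (y # xs))"
    using assms(2) by simp
  then show ?case
    using assms(1) by simp
qed (use assms in auto)

lemma switching_balanced:
  assumes "\<And>v. s v * s v = (1 :: int)" "\<And>u v. {u, v} \<in> edges G \<Longrightarrow> sig G {u, v} = s u * s v"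
  shows "balanced G"
  unfolding balanced_def
proof (intro allI impI)
  fix xs assume "is_cycle G xs"
  then have "walk G (xs @ [hd xs])" "xs \<noteq> []"
    by (auto simp: is_cycle_iff_walk)
  then show "cycle_sign G xs = 1"
    using walk_sign_switching[OF assms, of "xs @ [hd xs]"] assms(1)
    by (simp add: cycle_sign_eq_walk_sign)
qed

section \<open>Connected components and their switchings\<close>

lemma equiv_connection: "equiv (verts G) (connection G)"
proof (rule equivI)
  show "connection G \<subseteq> verts G \<times> verts G" "refl_on (verts G) (connection G)"
    by (auto simp: connection_def refl_on_def)
  have "sym ({(x, y). {x, y} \<in> edges G}\<^sup>*)"
    by (rule sym_rtrancl) (auto simp: sym_def insert_commute)
  then show "sym (connection G)"
    unfolding connection_def sym_def by blast
  show "trans (connection G)"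
    unfolding connection_def trans_def by (auto intro: rtrancl_trans)
qed

lemma component_edge:
  assumes G: "signed_graph G" and C: "C \<in> verts G // connection G" and e: "{u, v} \<in> edges G"
  shows "u \<in> C \<longleftrightarrow> v \<in> C"
proof -
  have "(u, v) \<in> connection G" "(v, u) \<in> connection G"
    using edge_ends[OF G e] e by (auto simp: connection_def insert_commute)
  then show ?thesis
    using in_quotient_imp_closed[OF equiv_connection C] by blast
qed

lemma component_connected:
  assumes "C \<in> verts G // connection G" "u \<in> C" "v \<in> C"
  shows "(u, v) \<in> {(x, y). {x, y} \<in> edges G}\<^sup>*"
  using in_quotient_imp_in_rel[OF equiv_connection assms(1)] assms(2,3) by (auto simp: connection_def)

lemma component_subset: "C \<in> verts G // connection G \<Longrightarrow> C \<subseteq> verts G"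
  by (rule in_quotient_imp_subset[OF equiv_connection])

lemma component_ex1:
  assumes "v \<in> verts G"
  shows "\<exists>!C. C \<in> verts G // connection G \<and> v \<in> C"
proof
  let ?C = "connection G `` {v}"
  show "?C \<in> verts G // connection G \<and> v \<in> ?C"
    using assms equiv_class_self[OF equiv_connection assms] by (auto intro: quotientI)
  then show "C = ?C" if "C \<in> verts G // connection G \<and> v \<in> C" for C
    using that quotient_disj[OF equiv_connection] by blast
qed

text \<open>Components may be counted by vertex sets because \<open>induced\<close> stores its set
  and is therefore injective.\<close>

lemma num_balanced_eq:
  "num_balanced G = card {C \<in> verts G // connection G. balanced (induced G C)}"
proof -
  have "inj_on (induced G) {C \<in> verts G // connection G. balanced (induced G C)}"
    by (rule inj_onI) (auto simp: induced_def)
  moreover have "{K \<in> graph_components G. balanced K} =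
      induced G ` {C \<in> verts G // connection G. balanced (induced G C)}"
    unfolding graph_components_def by auto
  ultimately show ?thesis
    unfolding num_balanced_def by (simp add: card_image)
qed

lemma signed_graph_induced: "signed_graph G \<Longrightarrow> C \<subseteq> verts G \<Longrightarrow> signed_graph (induced G C)"
  unfolding signed_graph_def induced_def by (auto intro: finite_subset)

lemma balanced_component_switching:
  assumes G: "signed_graph G" and C: "C \<in> verts G // connection G" and bal: "balanced (induced G C)"
  shows "\<exists>s :: 'a \<Rightarrow> int. (\<forall>v\<in>C. s v * s v = 1) \<and>
    (\<forall>u\<in>C. \<forall>v. {u, v} \<in> edges G \<longrightarrow> sig G {u, v} = s u * s v)"
proof -
  let ?K = "induced G C"
  obtain r where r: "r \<in> C"
    using in_quotient_imp_non_empty[OF equiv_connection C] by blast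
  have "\<exists>xs. walk ?K (r # xs) \<and> last (r # xs) = v" if "v \<in> C" for v
    using component_connected[OF C r that]
  proof (induction rule: rtrancl_induct)
    case base
    show ?case
      by (intro exI[of _ "[]"]) simp
  next
    case (step y z)
    then obtain xs where xs: "walk ?K (r # xs)" "last (r # xs) = y"
      by blast
    have e: "{y, z} \<in> edges G"
      using step by simp
    \<comment> \<open>Connectivity is along edges of \<open>G\<close>; the path stays in
      \<open>C\<close>, so it is also a walk in the induced subgraph.\<close>
    have "(r, y) \<in> connection G"
      using step(1) r component_subset[OF C] edge_ends[OF G e] by (auto simp: connection_def)
    then have "y \<in> C"
      using in_quotient_imp_closed[OF equiv_connection C r] by blast
    then have e': "{y, z} \<in> edges ?K"
      using e component_edge[OF G C e] by (simp add: induced_def)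
    obtain ys where ys: "r # xs = ys @ [y]"
      using xs(2) by (metis append_butlast_last_id list.distinct(1))
    have "walk ?K (r # xs @ [z])"
      using xs(1) e' walk_append[of ?K ys y "[z]"] ys
      by (metis append_Cons append_Nil append.assoc walk.simps(1,3))
    then show ?case
      by (intro exI[of _ "xs @ [z]"]) simp
  qed
  then obtain s where s: "\<forall>v\<in>verts ?K. s v * s v = (1::int)"
      "\<forall>u v. {u, v} \<in> edges ?K \<longrightarrow> sig ?K {u, v} = s u * s v"
    using balanced_ex_switching[OF signed_graph_induced[OF G component_subset[OF C]] bal, of r]
    by (auto simp: induced_def)
  then show ?thesis
    using component_edge[OF G C] by (intro exI[of _ s]) (auto simp: induced_def)
qed

text \<open>The sign pattern of a nowhere vanishing kernel function is a switching.\<close>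

lemma kernel_zero_on_unbalanced:
  fixes f :: "'a \<Rightarrow> real"
  assumes G: "signed_graph G" and C: "C \<in> verts G // connection G"
    and f: "\<And>u v. {u, v} \<in> edges G \<Longrightarrow> f u = real_of_int (sig G {u, v}) * f v"
    and r: "r \<in> C" "f r \<noteq> 0"
  shows "balanced (induced G C)"
proof -
  have sg: "sig G e = 1 \<or> sig G e = -1" if "e \<in> edges G" for e
    using G that unfolding signed_graph_def by blast
  \<comment> \<open>Across an edge \<open>f\<close> changes at most its sign, so a nonzero value
    spreads over the whole component.\<close>
  have nz: "f v \<noteq> 0" if "v \<in> C" for v
    using component_connected[OF C r(1) that]
  proof (induction rule: rtrancl_induct)
    case (step y z)
    then show ?case
      using f[of y z] by auto
  qed (rule r(2))
  define s where "s v = (if f v > 0 then 1 else - 1 :: int)" for v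
  have "sig G {u, v} = s u * s v" if "{u, v} \<in> edges G" "u \<in> C" for u v
    using sg[OF that(1)] f[OF that(1)] nz[of u] nz[of v] that component_edge[OF G C that(1)]
    by (auto simp: s_def)
  then show ?thesis
    by (intro switching_balanced[of s]) (auto simp: s_def induced_def)
qed

text \<open>Expanding \<open>g\<close> in the eigenfunctions shows that the dual functions are left
  eigenfunctions of \<open>M\<close>. Hence a function in the kernel has no coefficient at a nonzero
  eigenvalue.\<close>

lemma eigensystem_coefficient:
  assumes es: "eigensystem A M I lam F F'" and fin: "finite A" "finite I" and i: "i \<in> I"
  shows "(\<Sum>u\<in>A. F' i u * (\<Sum>v\<in>A. M u v * g v)) = lam i * (\<Sum>v\<in>A. F' i v * g v)"
proof -
  note E = eigensystemD[OF es]
  define c where "c j = (\<Sum>v\<in>A. F' j v * g v)" for j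
  have g: "g u = (\<Sum>j\<in>I. F j u * c j)" if u: "u \<in> A" for u
  proof -
    have "(\<Sum>j\<in>I. F j u * c j) = (\<Sum>v\<in>A. (\<Sum>j\<in>I. F j u * F' j v) * g v)"
      unfolding c_def sum_distrib_left sum_distrib_right mult.assoc by (rule sum.swap)
    also have "\<dots> = (\<Sum>v\<in>A. if u = v then g u else 0)"
      using E(2) u by (intro sum.cong) auto
    finally show ?thesis
      using fin u by simp
  qed
  have "(\<Sum>v\<in>A. M u v * g v) = (\<Sum>j\<in>I. lam j * c j * F j u)" if u: "u \<in> A" for u
  proof -
    have "(\<Sum>v\<in>A. M u v * g v) = (\<Sum>v\<in>A. \<Sum>j\<in>I. c j * (M u v * F j v))"
      using g by (simp add: sum_distrib_left ac_simps)
    also have "\<dots> = (\<Sum>j\<in>I. c j * (\<Sum>v\<in>A. M u v * F j v))"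
      by (subst sum.swap) (simp add: sum_distrib_left)
    also have "\<dots> = (\<Sum>j\<in>I. lam j * c j * F j u)"
      using E(3) u by (intro sum.cong) auto
    finally show ?thesis .
  qed
  then have "(\<Sum>u\<in>A. F' i u * (\<Sum>v\<in>A. M u v * g v)) =
      (\<Sum>u\<in>A. \<Sum>j\<in>I. lam j * c j * (F' i u * F j u))"
    by (simp add: sum_distrib_left ac_simps)
  also have "\<dots> = (\<Sum>j\<in>I. lam j * c j * (\<Sum>u\<in>A. F' i u * F j u))"
    by (subst sum.swap) (simp add: sum_distrib_left)
  also have "\<dots> = (\<Sum>j\<in>I. if i = j then lam i * c i else 0)"
    using E(1) i by (intro sum.cong) auto
  finally show ?thesis
    using fin i by (simp add: c_def)
qed

text \<open>
  The kernel of the Laplacian has two bases: the eigenfunctions of eigenvalue zero, and the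
  switching functions of the balanced components extended by zero. Expanding each basis in the
  other and taking traces equates their sizes.
\<close>

theorem card_zero_laplacian_eigenvalues:
  assumes G: "signed_graph G" and I: "finite I"
    and es: "eigensystem (verts G) (laplacian G) I lam F F'"
  shows "card {i \<in> I. lam i = 0} = num_balanced G"
proof -
  let ?V = "verts G"
  define B where "B = {C \<in> ?V // connection G. balanced (induced G C)}"
  define Z where "Z = {i \<in> I. lam i = 0}"
  note E = eigensystemD[OF es]
  have fin: "finite ?V"
    using G by (simp add: signed_graph_def)
  have BC: "C \<in> ?V // connection G" if "C \<in> B" for C
    using that by (simp add: B_def)
  have finC: "finite C" if "C \<in> B" for C
    using component_subset[OF BC[OF that]] fin finite_subset by blast
  have finB: "finite B"
    using fin component_subset by (intro finite_subset[of B "Pow ?V"]) (auto simp: B_def)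
  have "\<forall>C\<in>B. \<exists>s :: 'a \<Rightarrow> int. (\<forall>v\<in>C. s v * s v = 1) \<and>
      (\<forall>u\<in>C. \<forall>v. {u, v} \<in> edges G \<longrightarrow> sig G {u, v} = s u * s v)"
    using balanced_component_switching[OF G] by (auto simp: B_def)
  then obtain s :: "'a set \<Rightarrow> 'a \<Rightarrow> int" where s: "\<And>C v. C \<in> B \<Longrightarrow> v \<in> C \<Longrightarrow> s C v * s C v = 1"
      "\<And>C u v. C \<in> B \<Longrightarrow> u \<in> C \<Longrightarrow> {u, v} \<in> edges G \<Longrightarrow> sig G {u, v} = s C u * s C v"
    by metis
  define f where "f C v = (if v \<in> C then real_of_int (s C v) else 0)" for C v
  have f_sq: "f C v * f C v = 1" if "C \<in> B" "v \<in> C" for C v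
    using s(1)[OF that] that by (simp add: f_def flip: of_int_mult)
  have f_edge: "f C u = real_of_int (sig G {u, v}) * f C v" if C: "C \<in> B" and e: "{u, v} \<in> edges G" for C u v
  proof (cases "u \<in> C")
    case True
    then have v: "v \<in> C"
      using component_edge[OF G BC[OF C] e] by simp
    have "sig G {u, v} * s C v = s C u * (s C v * s C v)"
      using s(2)[OF C True e] by simp
    also have "\<dots> = s C u"
      using s(1)[OF C v] by simp
    finally show ?thesis
      using True v by (simp add: f_def flip: of_int_mult)
  next
    case False
    then show ?thesis
      using component_edge[OF G BC[OF C] e] by (simp add: f_def)
  qed
  have f_kernel: "(\<Sum>v\<in>?V. laplacian G u v * f C v) = 0" if "C \<in> B" "u \<in> ?V" for C u
    unfolding laplacian_action[OF G that(2)]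
    using f_edge[OF that(1)] by (intro sum.neutral) (auto simp: neighbours_def)
  \<comment> \<open>The functions \<open>f C\<close> have disjoint supports and squared norm
    \<open>card C\<close>, so these are the usual coefficients for an orthogonal basis of the
    kernel.\<close>
  have expand: "h v = (\<Sum>C\<in>B. f C v * ((\<Sum>w\<in>?V. h w * f C w) / card C))"
    if h: "\<And>u v. {u, v} \<in> edges G \<Longrightarrow> h u = real_of_int (sig G {u, v}) * h v" and v: "v \<in> ?V"
    for h :: "'a \<Rightarrow> real" and v
  proof -
    obtain D where D: "D \<in> ?V // connection G" "v \<in> D"
      and uniq: "\<And>C. C \<in> ?V // connection G \<Longrightarrow> v \<in> C \<Longrightarrow> C = D"
      using component_ex1[OF v] by auto
    have other: "f C v = 0" if "C \<in> B" "C \<noteq> D" for C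
      using uniq[OF BC] that by (auto simp: f_def)
    show ?thesis
    proof (cases "D \<in> B")
      case False
      then have "h v = 0"
        using kernel_zero_on_unbalanced[OF G D(1) h D(2)] D(1) by (auto simp: B_def)
      moreover have "f C v = 0" if "C \<in> B" for C
        using other that False by blast
      ultimately show ?thesis
        by simp
    next
      case True
      \<comment> \<open>Along an edge \<open>h\<close> and \<open>f D\<close> are multiplied by the
        same sign, so their product stays constant on \<open>D\<close>.\<close>
      have const: "h w * f D w = h v * f D v" if "w \<in> D" for w
        using component_connected[OF D that]
      proof (induction rule: rtrancl_induct)
        case (step y z)
        then have e: "{y, z} \<in> edges G" by simp
        have "h y * f D y = (real_of_int (sig G {y, z}) * real_of_int (sig G {y, z})) * (h z * f D z)"
          using h[OF e] f_edge[OF True e] by simp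
        also have "\<dots> = h z * f D z"
          using sig_square[OF G e] by (simp flip: of_int_mult)
        finally show ?case
          using step by simp
      qed simp
      have "(\<Sum>w\<in>?V. h w * f D w) = (\<Sum>w\<in>D. h w * f D w)"
        using component_subset[OF D(1)] fin by (intro sum.mono_neutral_right) (auto simp: f_def)
      also have "\<dots> = card D * (h v * f D v)"
        using const by simp
      finally have "f D v * ((\<Sum>w\<in>?V. h w * f D w) / card D) = h v * (f D v * f D v)"
        using finC[OF True] D(2) by (auto simp: card_gt_0_iff)
      also have "\<dots> = h v"
        using f_sq[OF True D(2)] by simp
      finally have "f D v * ((\<Sum>w\<in>?V. h w * f D w) / card D) = h v" .
      moreover have "(\<Sum>C\<in>B. f C v * ((\<Sum>w\<in>?V. h w * f C w) / card C)) =
          f D v * ((\<Sum>w\<in>?V. h w * f D w) / card D)"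
        using finB True other by (subst sum.remove[of _ D]) (auto intro!: sum.neutral)
      ultimately show ?thesis
        by simp
    qed
  qed
  \<comment> \<open>\<open>a i C\<close> is the coefficient of \<open>f C\<close> at
    \<open>F i\<close>, and \<open>b i C / card C\<close> that of \<open>F i\<close> at
    \<open>f C\<close>; these are the matrices of the two base changes.\<close>
  define a b where "a i C = (\<Sum>v\<in>?V. F' i v * f C v)" and "b i C = (\<Sum>v\<in>?V. F i v * f C v)" for i C
  have "real (card Z) = (\<Sum>i\<in>Z. \<Sum>C\<in>B. a i C * b i C / card C)"
  proof -
    have "(\<Sum>C\<in>B. a i C * b i C / card C) = 1" if i: "i \<in> Z" for i
    proof -
      have iI: "i \<in> I" and 0: "lam i = 0"
        using i by (auto simp: Z_def)
      have "F i v = (\<Sum>C\<in>B. f C v * (b i C / card C))" if "v \<in> ?V" for v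
        unfolding b_def using E(3)[OF iI] 0 that
        by (intro expand laplacian_kernel_edge[OF G]) auto
      then have "1 = (\<Sum>v\<in>?V. F' i v * (\<Sum>C\<in>B. f C v * (b i C / card C)))"
        using E(1)[OF iI iI] by simp
      also have "\<dots> = (\<Sum>C\<in>B. \<Sum>v\<in>?V. F' i v * f C v * (b i C / card C))"
        unfolding sum_distrib_left by (subst sum.swap) (simp add: ac_simps)
      also have "\<dots> = (\<Sum>C\<in>B. a i C * b i C / card C)"
        unfolding a_def by (simp add: sum_distrib_right sum_divide_distrib)
      finally show ?thesis by simp
    qed
    then show ?thesis by simp
  qed
  also have "\<dots> = (\<Sum>C\<in>B. (\<Sum>i\<in>Z. a i C * b i C) / card C)"
    by (subst sum.swap) (simp add: sum_divide_distrib)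
  also have "\<dots> = (\<Sum>C\<in>B. 1)"
  proof (rule sum.cong)
    fix C assume C: "C \<in> B"
    \<comment> \<open>This allows the sum over \<open>Z\<close> to be extended to all of
      \<open>I\<close>, where completeness of the eigenfunctions applies.\<close>
    have "a i C = 0" if "i \<in> I - Z" for i
    proof -
      have i: "i \<in> I" "lam i \<noteq> 0"
        using that by (auto simp: Z_def)
      then show ?thesis
        using eigensystem_coefficient[OF es fin I i(1), of "f C"] f_kernel[OF C] by (simp add: a_def)
    qed
    then have "(\<Sum>i\<in>Z. a i C * b i C) = (\<Sum>i\<in>I. a i C * b i C)"
      using I by (intro sum.mono_neutral_left) (auto simp: Z_def)
    also have "\<dots> = (\<Sum>i\<in>I. \<Sum>v\<in>?V. \<Sum>w\<in>?V. f C v * f C w * (F i w * F' i v))"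
      unfolding a_def b_def sum_product by (simp add: ac_simps)
    also have "\<dots> = (\<Sum>v\<in>?V. \<Sum>i\<in>I. \<Sum>w\<in>?V. f C v * f C w * (F i w * F' i v))"
      by (rule sum.swap)
    also have "\<dots> = (\<Sum>v\<in>?V. \<Sum>w\<in>?V. f C v * f C w * (\<Sum>i\<in>I. F i w * F' i v))"
      unfolding sum_distrib_left by (intro sum.cong refl sum.swap)
    also have "\<dots> = (\<Sum>v\<in>?V. \<Sum>w\<in>?V. if w = v then f C v * f C v else 0)"
      using E(2) by (intro sum.cong refl) auto
    also have "\<dots> = (\<Sum>v\<in>?V. f C v * f C v)"
      using fin by simp
    also have "\<dots> = (\<Sum>v\<in>C. 1)"
      using component_subset[OF BC[OF C]] fin f_sq[OF C]
      by (intro sum.mono_neutral_cong_right) (auto simp: f_def)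
    finally show "(\<Sum>i\<in>Z. a i C * b i C) / card C = 1"
      using finC[OF C] in_quotient_imp_non_empty[OF equiv_connection BC[OF C]] by simp
  qed simp
  finally show ?thesis
    by (simp add: Z_def B_def num_balanced_eq)
qed

section \<open>The spectrum of the line graph\<close>

text \<open>Sylvester's determinant identity with a parameter \<open>y\<close> that need not be
  invertible, as it will be a polynomial. The block matrix \<open>X\<close> is cleared of
  \<open>B\<close> from the right by \<open>R\<close>, of determinant 1, and from the left by
  \<open>S\<close>, which must scale the lower rows by \<open>y\<close> and so costs the factor
  \<open>y ^ m\<close>.\<close>

lemma det_scalar_plus_mult_swap:
  fixes y :: "'b :: idom"
  assumes A: "A \<in> carrier_mat n m" and B: "B \<in> carrier_mat m n"
  shows "y ^ m * det (y \<cdot>\<^sub>m 1\<^sub>m n + A * B) = y ^ n * det (y \<cdot>\<^sub>m 1\<^sub>m m + B * A)"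
proof -
  define X where "X = four_block_mat (y \<cdot>\<^sub>m 1\<^sub>m n) (- A) B (1\<^sub>m m)"
  have X: "X \<in> carrier_mat (n + m) (n + m)"
    unfolding X_def using A B by auto
  define R where "R = four_block_mat (1\<^sub>m n) (0\<^sub>m n m) (- B) (1\<^sub>m m)"
  have R: "R \<in> carrier_mat (n + m) (n + m)"
    unfolding R_def using B by auto
  define S where "S = four_block_mat (1\<^sub>m n) (0\<^sub>m n m) (- B) (y \<cdot>\<^sub>m 1\<^sub>m m)"
  have S: "S \<in> carrier_mat (n + m) (n + m)"
    unfolding S_def using B by auto
  have "X * R = four_block_mat (y \<cdot>\<^sub>m 1\<^sub>m n + A * B) (- A) (0\<^sub>m m n) (1\<^sub>m m)"
    unfolding X_def R_def using A B
    by (subst mult_four_block_mat[of _ n n _ m _ m _ _ n _ m]) auto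
  then have "det X * det R = det (y \<cdot>\<^sub>m 1\<^sub>m n + A * B)"
    using A B det_mult[OF X R]
    by (simp add: det_four_block_mat_lower_left_zero[of _ n _ m])
  moreover have "det R = 1"
    unfolding R_def using B by (subst det_four_block_mat_upper_right_zero[of _ n _ m]) auto
  ultimately have 1: "det X = det (y \<cdot>\<^sub>m 1\<^sub>m n + A * B)"
    by simp
  have "S * X = four_block_mat (y \<cdot>\<^sub>m 1\<^sub>m n) (- A) (0\<^sub>m m n) (y \<cdot>\<^sub>m 1\<^sub>m m + B * A)"
    unfolding X_def S_def using A B
    by (subst mult_four_block_mat[of _ n n _ m _ m _ _ n _ m])
      (auto intro!: arg_cong2[where f = "four_block_mat _ _"] eq_matI simp: add.commute)
  then have "det S * det X = y ^ n * det (y \<cdot>\<^sub>m 1\<^sub>m m + B * A)"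
    using A B det_mult[OF S X]
    by (simp add: det_four_block_mat_lower_left_zero[of _ n _ m] det_smult)
  moreover have "det S = y ^ m"
    unfolding S_def using B
    by (subst det_four_block_mat_upper_right_zero[of _ n _ m]) (auto simp: det_smult)
  ultimately show ?thesis
    using 1 by simp
qed

lemma char_poly_gram_swap:
  fixes H :: "'a \<Rightarrow> 'e \<Rightarrow> real"
  assumes "finite A" "finite E"
  shows "[:- c, 1:] ^ card E *
      char_poly (mat_on A (\<lambda>u v. (if u = v then c else 0) - (\<Sum>e\<in>E. H u e * H v e))) =
    [:- c, 1:] ^ card A *
      char_poly (mat_on E (\<lambda>e f. (if e = f then c else 0) - (\<Sum>v\<in>A. H v e * H v f)))"
proof -
  define xs ys where "xs = enumeration A" and "ys = enumeration E"
  have xs: "distinct xs" "set xs = A" and ys: "distinct ys" "set ys = E"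
    unfolding xs_def ys_def using enumeration assms by auto
  define n m where "n = length xs" and "m = length ys"
  have nm: "n = card A" "m = card E"
    unfolding n_def m_def using xs ys distinct_card by metis+
  \<comment> \<open>The determinants live over polynomials, so the entries become constant
    polynomials; \<open>x - c\<close> plays the role of \<open>y\<close>.\<close>
  define N where "N = mat n m (\<lambda>(i, k). [:H (xs ! i) (ys ! k):])"
  define N' where "N' = mat m n (\<lambda>(k, i). [:H (xs ! i) (ys ! k):])"
  have sum_const: "(\<Sum>k = 0..<l. [:h k:]) = [:\<Sum>k = 0..<l. h k:]" for l and h :: "nat \<Rightarrow> real"
    by (induction l) auto
  have sumA: "sum h A = (\<Sum>k = 0..<n. h (xs ! k))" for h :: "_ \<Rightarrow> real"
    using sum_nth_distinct[OF xs(1), of h] xs n_def by simp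
  have sumE: "sum h E = (\<Sum>k = 0..<m. h (ys ! k))" for h :: "_ \<Rightarrow> real"
    using sum_nth_distinct[OF ys(1), of h] ys m_def by simp
  have "char_poly (mat_on A (\<lambda>u v. (if u = v then c else 0) - (\<Sum>e\<in>E. H u e * H v e))) =
      det ([:- c, 1:] \<cdot>\<^sub>m 1\<^sub>m n + N * N')"
    unfolding char_poly_defs mat_on_def mat_along_def xs_def[symmetric] n_def[symmetric]
    by (rule arg_cong[where f = det], rule eq_matI)
      (auto simp: N_def N'_def scalar_prod_def sum_const sumE mult.commute nth_eq_iff_index_eq xs n_def)
  moreover have "char_poly (mat_on E (\<lambda>e f. (if e = f then c else 0) - (\<Sum>v\<in>A. H v e * H v f))) =
      det ([:- c, 1:] \<cdot>\<^sub>m 1\<^sub>m m + N' * N)"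
    unfolding char_poly_defs mat_on_def mat_along_def ys_def[symmetric] m_def[symmetric]
    by (rule arg_cong[where f = det], rule eq_matI)
      (auto simp: N_def N'_def scalar_prod_def sum_const sumA mult.commute nth_eq_iff_index_eq ys m_def)
  ultimately show ?thesis
    using det_scalar_plus_mult_swap[of N n m N' "[:- c, 1:]"] nm by (simp add: N_def N'_def)
qed

lemma mat_on_cong:
  assumes "finite A" "\<And>u v. u \<in> A \<Longrightarrow> v \<in> A \<Longrightarrow> f u v = g u v"
  shows "mat_on A f = mat_on A g"
  unfolding mat_on_def mat_along_def
  using assms(2) nth_mem[of _ "enumeration A"] unfolding enumeration(2)[OF assms(1)]
  by (intro cong_mat) auto

lemma proots_linear_power: "proots ([:- c, 1:] ^ k) = replicate_mset k (c :: 'b :: idom)"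
proof -
  have "repeat_mset k {#c#} = replicate_mset k c"
    by (induction k) auto
  then show ?thesis
    by (simp add: proots_power)
qed

lemma proots_prod_linear:
  "finite I \<Longrightarrow> proots (\<Prod>i\<in>I. [:- lam i, 1:]) = image_mset lam (mset_set I)"
  for lam :: "'i \<Rightarrow> 'b :: idom"
  by (subst proots_prod) (auto, induction I rule: finite_induct, auto)

lemma proots_linear_power_mult_char_poly:
  "proots ([:- c, 1:] ^ k * char_poly (mat_on A f)) =
    replicate_mset k c + proots (char_poly (mat_on A f))"
proof -
  have "char_poly (mat_on A f) \<noteq> 0"
    using degree_monic_char_poly[of "mat_on A f" "length (enumeration A)"]
    by (auto simp: mat_on_def mat_along_def)
  moreover have "[:- c, 1:] ^ k \<noteq> 0"
    by simp
  ultimately show ?thesis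
    unfolding proots_linear_power[symmetric] by (intro proots_mult)
qed

text \<open>Copies of 2 are added on both sides so that one identity covers \<open>m - n\<close> of
  either sign without truncated subtraction.\<close>

lemma line_graph_eigenvalues:
  assumes G: "signed_graph G" and H: "incidence_matrix G H" and I: "finite I"
    and es: "eigensystem (verts G) (laplacian G) I lam F F'"
  shows "replicate_mset (card (edges G)) 2 + image_mset (\<lambda>i. 2 - lam i) (mset_set I) =
    replicate_mset (card (verts G)) 2 + eigenvalues (adjacency_mat (line_graph G H))"
proof -
  let ?N = "\<lambda>v e. real_of_int (H v e)"
  have fin: "finite (verts G)" "finite (edges G)"
    using G finite_edges by (auto simp: signed_graph_def)
  have "char_poly (mat_on (verts G) (\<lambda>u v. (if u = v then 2 else 0) - (\<Sum>e\<in>edges G. ?N u e * ?N v e))) =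
      char_poly (mat_on (verts G) (\<lambda>u v. (if u = v then 2 else 0) - laplacian G u v))"
    using incidence_gram[OF G H] by (intro arg_cong[where f = char_poly] mat_on_cong fin) auto
  also have "\<dots> = (\<Prod>i\<in>I. [:- (2 - lam i), 1:])"
    by (rule eigensystem_char_poly[OF fin(1) I eigensystem_const_minus[OF fin(1) es]])
  finally have 1: "proots (char_poly (mat_on (verts G)
      (\<lambda>u v. (if u = v then 2 else 0) - (\<Sum>e\<in>edges G. ?N u e * ?N v e)))) =
      image_mset (\<lambda>i. 2 - lam i) (mset_set I)"
    using proots_prod_linear[OF I, of "\<lambda>i. 2 - lam i"] by simp
  have "adjacency_mat (line_graph G H) =
      mat_on (edges G) (\<lambda>e f. (if e = f then 2 else 0) - (\<Sum>v\<in>verts G. ?N v e * ?N v f))"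
  proof -
    have "real_of_int (adjacency (line_graph G H) e f) =
        (if e = f then 2 else 0) - (\<Sum>v\<in>verts G. ?N v e * ?N v f)"
      if "e \<in> edges G" "f \<in> edges G" for e f
      using adjacency_line_graph[OF G H that] by simp
    then show ?thesis
      unfolding adjacency_mat_def using fin(2)
      by (simp add: line_graph_def) (intro mat_on_cong; simp add: line_graph_def)
  qed
  then have 2: "eigenvalues (adjacency_mat (line_graph G H)) = proots (char_poly (mat_on (edges G)
      (\<lambda>e f. (if e = f then 2 else 0) - (\<Sum>v\<in>verts G. ?N v e * ?N v f))))"
    by (simp add: eigenvalues_def)
  show ?thesis
    using arg_cong[OF char_poly_gram_swap[OF fin, of 2 ?N], of proots]
    unfolding proots_linear_power_mult_char_poly 1 2 .
qed

section \<open>The line graph of a Cartesian product\<close>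

theorem theorem3p11:
  fixes r :: nat and S :: "nat \<Rightarrow> 'a sgraph" and lam :: "nat \<Rightarrow> nat \<Rightarrow> real"
    and H :: "(nat \<Rightarrow> 'a) \<Rightarrow> (nat \<Rightarrow> 'a) set \<Rightarrow> int"
  defines "P \<equiv> cart_prod {1..r} S"
  defines "n \<equiv> card (verts P)" and "m \<equiv> card (edges P)"
  defines "J \<equiv> (\<Pi>\<^sub>E i\<in>{1..r}. {1..card (verts (S i))})"
  defines "ev \<equiv> (\<lambda>j. 2 - (\<Sum>i=1..r. lam i (j i)))"
  defines "L \<equiv> line_graph P H"
  assumes "r \<ge> 1"
    and "\<And>i. i \<in> {1..r} \<Longrightarrow> signed_graph (S i) \<and> verts (S i) \<noteq> {}"
    and "\<And>i. i \<in> {1..r} \<Longrightarrow>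
           eigenvalues (laplacian_mat (S i)) = image_mset (lam i) (mset_set {1..card (verts (S i))})"
    and "incidence_matrix P H"
  shows "n = (\<Prod>i=1..r. card (verts (S i))) \<and>
     average_degree P = (\<Sum>i=1..r. average_degree (S i)) \<and>
     real m = 1/2 * real n * average_degree P \<and>
     num_balanced P = (\<Prod>i=1..r. num_balanced (S i)) \<and>
     card {j \<in> J. ev j = 2} = num_balanced P \<and>
     (\<forall>j\<in>J. ev j \<noteq> 2 \<longrightarrow> ev j < 2) \<and>
     real m - real n = real n * (1/2 * average_degree P - 1) \<and>
     (m \<ge> n \<longrightarrow>
        eigenvalues (adjacency_mat L) = image_mset ev (mset_set J) + replicate_mset (m - n) 2) \<and>
     (m < n \<longrightarrow>
        n - m \<le> num_balanced P \<and>
        eigenvalues (adjacency_mat L) = image_mset ev (mset_set J) - replicate_mset (n - m) 2) \<and>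
     energy L = (\<Sum>j\<in>J. \<bar>(\<Sum>i=1..r. lam i (j i)) - 2\<bar>) + 2 * (real m - real n)"
proof -
  let ?K = "{1..r}"
  let ?I = "\<lambda>i. {1..card (verts (S i))}"
  have S: "signed_graph (S i)" and ne: "verts (S i) \<noteq> {}" if "i \<in> ?K" for i
    using assms(8) that by auto
  have fin: "finite (verts (S i))" if "i \<in> ?K" for i
    using S[OF that] by (simp add: signed_graph_def)
  have P: "signed_graph P"
    unfolding P_def by (rule signed_graph_cart_prod) (use S in auto)
  have V: "verts P = (\<Pi>\<^sub>E i\<in>?K. verts (S i))"
    by (simp add: P_def cart_prod_def)
  have n: "n = (\<Prod>i=1..r. card (verts (S i)))"
    unfolding n_def V by (rule card_PiE) simp
  have "n > 0"
    unfolding n using fin ne by (auto simp: card_gt_0_iff intro!: prod_pos)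
  have m: "real m = 1/2 * real n * average_degree P"
    using \<open>n > 0\<close> by (simp add: average_degree_def m_def n_def)
  have J: "finite J"
    unfolding J_def by (intro finite_PiE) auto
  have "\<forall>i\<in>?K. \<exists>F F'. eigensystem (verts (S i)) (laplacian (S i)) (?I i) (lam i) F F'"
  proof
    fix i assume i: "i \<in> ?K"
    show "\<exists>F F'. eigensystem (verts (S i)) (laplacian (S i)) (?I i) (lam i) F F'"
      using assms(9)[OF i]
      by (intro ex_eigensystem fin[OF i] laplacian_sym) (simp_all add: laplacian_mat_eq)
  qed
  then obtain F F' where es:
    "\<And>i. i \<in> ?K \<Longrightarrow> eigensystem (verts (S i)) (laplacian (S i)) (?I i) (lam i) (F i) (F' i)"
    by metis
  have esP: "eigensystem (verts P) (laplacian P) J (\<lambda>j. \<Sum>i=1..r. lam i (j i))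
      (\<lambda>j u. \<Prod>i\<in>?K. F i (j i) (u i)) (\<lambda>j u. \<Prod>i\<in>?K. F' i (j i) (u i))"
    unfolding V J_def
  proof (rule eigensystem_PiE[OF _ fin _ es])
    fix f :: "(nat \<Rightarrow> 'a) \<Rightarrow> real" and u assume "u \<in> (\<Pi>\<^sub>E i\<in>?K. verts (S i))"
    then show "(\<Sum>v\<in>(\<Pi>\<^sub>E i\<in>?K. verts (S i)). laplacian P u v * f v) =
        (\<Sum>i=1..r. \<Sum>w\<in>verts (S i). laplacian (S i) (u i) w * f (u(i := w)))"
      using laplacian_cart_prod[of ?K S u f] S unfolding P_def[symmetric] V by simp
  qed auto
  have nonneg: "0 \<le> lam i k" if "i \<in> ?K" "k \<in> ?I i" for i k
    using laplacian_eigenvalue_nonneg[OF S[OF that(1)] es[OF that(1)] that(2)] .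
  have sum0: "(\<Sum>i=1..r. lam i (j i)) = 0 \<longleftrightarrow> (\<forall>i\<in>?K. lam i (j i) = 0)" if "j \<in> J" for j
    using nonneg PiE_mem[of j ?K ?I] that unfolding J_def by (intro sum_nonneg_eq_0_iff) auto
  have zeros: "card {j \<in> J. ev j = 2} = num_balanced P"
    using card_zero_laplacian_eigenvalues[OF P J esP] by (simp add: ev_def)
  \<comment> \<open>Nonnegativity makes the vanishing of the sum a condition on each coordinate
    separately, so the solutions form a product set and their number is a product.\<close>
  have "{j \<in> J. ev j = 2} = (\<Pi>\<^sub>E i\<in>?K. {k \<in> ?I i. lam i k = 0})"
  proof -
    have "{j \<in> J. ev j = 2} = {j \<in> J. \<forall>i\<in>?K. lam i (j i) = 0}"
      using sum0 by (auto simp: ev_def)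
    also have "\<dots> = (\<Pi>\<^sub>E i\<in>?K. {k \<in> ?I i. lam i k = 0})"
      unfolding J_def set_eq_iff mem_Collect_eq PiE_iff by blast
    finally show ?thesis .
  qed
  then have "card {j \<in> J. ev j = 2} = (\<Prod>i=1..r. card {k \<in> ?I i. lam i k = 0})"
    by (simp add: card_PiE)
  also have "\<dots> = (\<Prod>i=1..r. num_balanced (S i))"
    using card_zero_laplacian_eigenvalues[OF S _ es] by (intro prod.cong) auto
  finally have balanced: "num_balanced P = (\<Prod>i=1..r. num_balanced (S i))"
    using zeros by simp
  have le: "ev j < 2" if "j \<in> J" "ev j \<noteq> 2" for j
  proof -
    have "0 \<le> (\<Sum>i=1..r. lam i (j i))"
      using nonneg PiE_mem[of j ?K ?I] that(1) unfolding J_def by (intro sum_nonneg) auto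
    then show ?thesis
      using that(2) by (simp add: ev_def)
  qed
  define X where "X = eigenvalues (adjacency_mat L)"
  have eq: "replicate_mset m 2 + image_mset ev (mset_set J) = replicate_mset n 2 + X"
    using line_graph_eigenvalues[OF P assms(10) J esP] by (simp add: ev_def X_def L_def m_def n_def)
  have X1: "X = image_mset ev (mset_set J) + replicate_mset (m - n) 2" if "n \<le> m"
  proof -
    have "replicate_mset m (2::real) = replicate_mset n 2 + replicate_mset (m - n) 2"
      using that by (intro multiset_eqI) auto
    then show ?thesis
      using eq by (simp add: ac_simps)
  qed
  have X2: "image_mset ev (mset_set J) = replicate_mset (n - m) 2 + X" if "m < n"
  proof -
    have "replicate_mset n (2::real) = replicate_mset m 2 + replicate_mset (n - m) 2"
      using that by (intro multiset_eqI) auto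
    then show ?thesis
      using eq by (simp add: ac_simps)
  qed
  \<comment> \<open>Since \<open>X2\<close> holds as a sum of multisets, the copies of 2 to be
    deducted really occur among the listed values.\<close>
  have le_bal: "n - m \<le> num_balanced P" if "m < n"
  proof -
    have "count (image_mset ev (mset_set J)) 2 = card {j \<in> J. ev j = 2}"
      using J by (simp add: count_image_mset' vimage_def Int_def conj_commute eq_commute)
    moreover have "n - m \<le> count (image_mset ev (mset_set J)) 2"
      unfolding X2[OF that] by simp
    ultimately show ?thesis
      using zeros by simp
  qed
  have "(\<Sum>x\<in>#replicate_mset k 2. \<bar>x :: real\<bar>) = 2 * real k" for k
    by (induction k) auto
  \<comment> \<open>Summing absolute values over both sides of \<open>eq\<close> handles
    \<open>m < n\<close> and \<open>n \<le> m\<close> at once.\<close>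
  then have "2 * real m + (\<Sum>x\<in>#image_mset ev (mset_set J). \<bar>x\<bar>) = 2 * real n + energy L"
    using arg_cong[OF eq, of "\<lambda>M. \<Sum>x\<in>#M. \<bar>x\<bar>"]
    by (simp add: energy_def X_def del: sum_mset_replicate_mset)
  moreover have "(\<Sum>x\<in>#image_mset ev (mset_set J). \<bar>x\<bar>) = (\<Sum>j\<in>J. \<bar>(\<Sum>i=1..r. lam i (j i)) - 2\<bar>)"
    by (simp add: sum_unfold_sum_mset image_mset.compositionality comp_def ev_def abs_minus_commute)
  ultimately have energy: "energy L = (\<Sum>j\<in>J. \<bar>(\<Sum>i=1..r. lam i (j i)) - 2\<bar>) + 2 * (real m - real n)"
    by simp
  have "average_degree P = (\<Sum>i=1..r. average_degree (S i))"
    unfolding P_def by (rule average_degree_cart_prod) (use S ne in auto)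
  moreover have "real m - real n = real n * (1/2 * average_degree P - 1)"
    using m by (simp add: algebra_simps)
  ultimately show ?thesis
    using n m balanced zeros le X1 X2 le_bal energy unfolding X_def by auto
qed

end
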